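(* For any constant $c<\frac14$, there is no sequence $(I_n)_{n\ge 1}$ of intervals of the real line, with $I_n$ of length $n^{c}$, such that $\chi(G_{n,\frac12})\in I_n$ with high probability, i.e. such that $\mathbb{P}\big(\chi(G_{n,\frac12})\in I_n\big)\to 1$ as $n\to\infty$.
   Context: $G_{n,\frac12}$ denotes the binomial random graph on $n$ labelled vertices in which each possible edge is included independently with probability $\frac12$. $\chi(G)$ denotes the chromatic number of a graph $G$. The length of an interval $[s,t]$ is $t-s$. A sequence of events $(E_n)_{n}$ holds with high probability if $\mathbb{P}(E_n)\to1$ as $n\to\infty$. *)

theory Defs
  imports "HOL-Probability.Probability" "HOL-Library.Ramsey"
begin

type_synonym 'a ugraph = "'a set \<times> 'a set set"

definition simple_graph :: "'a ugraph \<Rightarrow> bool" where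
  "simple_graph G \<longleftrightarrow> finite (fst G) \<and> snd G \<subseteq> nsets (fst G) 2"

definition proper_colouring :: "'a ugraph \<Rightarrow> nat \<Rightarrow> ('a \<Rightarrow> nat) \<Rightarrow> bool" where
  "proper_colouring G k f \<longleftrightarrow>
     f ` fst G \<subseteq> {..<k} \<and> (\<forall>u v. {u, v} \<in> snd G \<longrightarrow> f u \<noteq> f v)"

definition chromatic_number :: "'a ugraph \<Rightarrow> nat" where
  "chromatic_number G = (LEAST k. \<exists>f. proper_colouring G k f)"

text \<open>
  The binomial random graph on the vertex set \<open>{0, \<dots>, n - 1}\<close>: one independent coin with success
  probability \<open>p\<close> is tossed for every two-element set of vertices, and the sets with a successful
  toss are the edges.  (The third argument of \<open>Pi_pmf\<close> lists the coins; the value \<open>False\<close> is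
  only its default outside the index set.)
\<close>

definition binomial_random_graph :: "nat \<Rightarrow> real \<Rightarrow> nat ugraph pmf" where
  "binomial_random_graph n p =
     map_pmf (\<lambda>w. ({..<n}, {e \<in> nsets {..<n} 2. w e}))
       (Pi_pmf (nsets {..<n} 2) False (\<lambda>_. bernoulli_pmf p))"

lemma simple_graph_binomial_random_graph:
  "G \<in> set_pmf (binomial_random_graph n p) \<Longrightarrow> simple_graph G \<and> fst G = {..<n}"
  by (auto simp: binomial_random_graph_def simple_graph_def)

lemma ex_proper_colouring:
  assumes "simple_graph G"
  shows "\<exists>f. proper_colouring G (card (fst G)) f"
proof -
  obtain f where f: "bij_betw f (fst G) {0..<card (fst G)}"
    using assms ex_bij_betw_finite_nat by (auto simp: simple_graph_def)
  have "f u \<noteq> f v" if e: "{u, v} \<in> snd G" for u v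
  proof -
    have uv: "{u, v} \<subseteq> fst G" "card {u, v} = 2"
      using e assms by (auto simp: simple_graph_def nsets_def)
    then have "u \<noteq> v" by auto
    with uv f show ?thesis
      by (auto simp: bij_betw_def inj_on_def)
  qed
  moreover have "f ` fst G \<subseteq> {..<card (fst G)}"
    using f by (auto simp: bij_betw_def)
  ultimately show ?thesis
    by (auto simp: proper_colouring_def)
qed

lemma chromatic_number_attained:
  assumes "simple_graph G"
  shows "\<exists>f. proper_colouring G (chromatic_number G) f"
  unfolding chromatic_number_def
  using ex_proper_colouring[OF assms]
  by (rule LeastI[where P = "\<lambda>k. \<exists>f. proper_colouring G k f"])

end

theory Submission
  imports Defs "HOL-Real_Asymp.Real_Asymp"
begin

text \<open>
  Let \<open>Z\<close> be the number of families of \<open>r\<close> disjoint independent \<open>k\<close>-sets.  If the expected number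
  of independent \<open>k\<close>-sets exceeds \<open>n\<^sup>1\<^sup>/\<^sup>2\<close> and \<open>r = n\<^bsup>c'\<^esup>\<close> with \<open>c' < 1/4\<close>, the
  second moment of \<open>Z\<close> is at most a constant times the square of its mean, so planting such a family
  does not change which events hold with high probability.  Removing the planted sets costs \<open>r\<close>
  colours and \<open>r k\<close> vertices.  Hence, if the chromatic number were concentrated on intervals of
  length \<open>n\<^bsup>c\<^esup>\<close> with \<open>c < c'\<close>, the intervals would move up by at most
  \<open>r (1 + o(1))\<close> when the number of vertices grows by \<open>r k\<close>.

  The least \<open>n\<close> for which this works with \<open>k\<close>-sets is about \<open>y\<^sub>k = k 2\<^bsup>k/2-1/4\<^esup> / e\<close>.  Going
  through all the windows from \<open>y\<^sub>j\<close> to \<open>y\<^bsub>j+1\<^esub>\<close> with \<open>j < k\<close>, where the slope is \<open>1/j\<close>, and then on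
  to \<open>n = k 2\<^bsup>k/2\<^esup> / e\<close> bounds the chromatic number by
  \<open>n/k + (2\<^bsup>1/4\<^esup> / (\<surd>2 - 1) + o(1)) n/k\<^sup>2\<close>.  Counting colourings, on the other hand,
  gives the lower bound \<open>n/k + (2 / ln 2 + o(1)) n/k\<^sup>2\<close> for the same \<open>n\<close>.  This is a contradiction since
  \<open>2\<^bsup>1/4\<^esup> / (\<surd>2 - 1) < 2.872\<close> and \<open>2 / ln 2 > 2.879\<close>.
\<close>

section \<open>Colourable graphs and planted independent sets\<close>

lemma chromatic_number_le_iff:
  assumes "simple_graph G"
  shows "chromatic_number G \<le> k \<longleftrightarrow> (\<exists>f. proper_colouring G k f)"
proof
  assume "chromatic_number G \<le> k"
  moreover obtain f where "proper_colouring G (chromatic_number G) f"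
    using chromatic_number_attained[OF assms] by blast
  ultimately have "proper_colouring G k f"
    unfolding proper_colouring_def by (meson lessThan_subset_iff order_trans)
  then show "\<exists>f. proper_colouring G k f" by blast
next
  assume "\<exists>f. proper_colouring G k f"
  then show "chromatic_number G \<le> k"
    unfolding chromatic_number_def by (rule Least_le)
qed

text \<open>At edge probability 1/2 the edge set is a uniformly random set of pairs, so
  probabilities become counts of edge sets divided by \<open>2 ^ (n choose 2)\<close>.\<close>

definition colourable_edges :: "'a set \<Rightarrow> nat \<Rightarrow> 'a set set set" where
  "colourable_edges V t = {S \<in> Pow (nsets V 2). \<exists>f. proper_colouring (V, S) t f}"

lemma finite_colourable_edges [simp]: "finite V \<Longrightarrow> finite (colourable_edges V t)"
  by (simp add: colourable_edges_def finite_imp_finite_nsets)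

lemma binomial_random_graph_half:
  "binomial_random_graph n (1/2) = map_pmf (Pair {..<n}) (pmf_of_set (Pow (nsets {..<n} 2)))"
proof -
  have "binomial_random_graph n (1/2) =
    map_pmf (Pair {..<n}) (map_pmf (\<lambda>w. {e \<in> nsets {..<n} 2. w e})
      (Pi_pmf (nsets {..<n} 2) False (\<lambda>_. bernoulli_pmf (1/2))))"
    by (simp add: binomial_random_graph_def map_pmf_comp)
  also have "\<dots> = map_pmf (Pair {..<n}) (pmf_of_set (Pow (nsets {..<n} 2)))"
    by (simp only: pmf_of_set_Pow_conv_bernoulli finite_imp_finite_nsets finite_lessThan)
  finally show ?thesis .
qed

lemma prob_chromatic_number_le:
  "measure_pmf.prob (binomial_random_graph n (1/2)) {G. chromatic_number G \<le> t} =
     card (colourable_edges {..<n} t) / 2 ^ (n choose 2)"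
proof -
  have fin: "finite (Pow (nsets {..<n} 2))"
    by (simp add: finite_imp_finite_nsets)
  have "Pow (nsets {..<n} 2) \<inter> {S. chromatic_number ({..<n}, S) \<le> t} = colourable_edges {..<n} t"
    by (auto simp: colourable_edges_def chromatic_number_le_iff simple_graph_def)
  then have "measure_pmf.prob (pmf_of_set (Pow (nsets {..<n} 2))) {S. chromatic_number ({..<n}, S) \<le> t} =
      card (colourable_edges {..<n} t) / card (Pow (nsets {..<n} 2))"
    using fin by (subst measure_pmf_of_set) auto
  moreover have "card (Pow (nsets {..<n} 2)) = 2 ^ (n choose 2)"
    by (simp add: card_Pow finite_imp_finite_nsets)
  ultimately show ?thesis
    by (simp add: binomial_random_graph_half vimage_def)
qed

text \<open>Removing a planted family leaves an arbitrary \<open>n\<close>-set of vertices, which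
  has to be compared with \<open>{..<n}\<close>; edge sets and colourings are relabelled along
  \<open>g\<close>.\<close>

lemma card_colourable_edges_le:
  assumes g: "bij_betw g V W" and fin: "finite V"
  shows "card (colourable_edges V t) \<le> card (colourable_edges W t)"
proof -
  have inj: "inj_on g V" and W: "W = g ` V"
    using g by (auto simp: bij_betw_def)
  have finW: "finite W" using W fin by simp
  have "inj_on ((`) ((`) g)) (colourable_edges V t)"
  proof (rule inj_on_subset)
    show "inj_on ((`) ((`) g)) (Pow (Pow V))"
      by (intro inj_on_image_Pow inj)
    show "colourable_edges V t \<subseteq> Pow (Pow V)" by (auto simp: colourable_edges_def nsets_def)
  qed
  moreover have "(`) ((`) g) ` colourable_edges V t \<subseteq> colourable_edges W t"
  proof safe
    fix S assume S: "S \<in> colourable_edges V t"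
    then obtain f where f: "proper_colouring (V, S) t f" and SV: "S \<subseteq> nsets V 2"
      by (auto simp: colourable_edges_def)
    have 1: "(`) g ` S \<subseteq> nsets W 2"
      using SV inj unfolding W nsets_def by (auto intro!: card_image[THEN trans] inj_on_subset[OF inj])
    have inv: "inv_into V g (g v) = v" if "v \<in> V" for v
      using inj that by (rule inv_into_f_f)
    have "proper_colouring (W, (`) g ` S) t (f \<circ> inv_into V g)"
      unfolding proper_colouring_def fst_conv snd_conv
    proof (intro conjI allI impI)
      show "(f \<circ> inv_into V g) ` W \<subseteq> {..<t}"
        using f by (auto simp: W inv proper_colouring_def)
      fix u v assume "{u, v} \<in> (`) g ` S"
      then obtain e where e: "e \<in> S" "{u, v} = g ` e" by blast
      then have "e \<subseteq> V" "card e = 2" using SV by (auto simp: nsets_def)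
      then obtain x y where xy: "e = {x, y}" "x \<in> V" "y \<in> V" by (auto simp: card_2_iff)
      have "f x \<noteq> f y" "f y \<noteq> f x" using f e xy by (auto simp: proper_colouring_def insert_commute)
      moreover have "u = g x \<and> v = g y \<or> u = g y \<and> v = g x"
        using e xy by (auto simp: doubleton_eq_iff)
      ultimately show "(f \<circ> inv_into V g) u \<noteq> (f \<circ> inv_into V g) v"
        using xy by (auto simp: inv)
    qed
    with 1 show "(`) ((`) g) S \<in> colourable_edges W t" by (auto simp: colourable_edges_def)
  qed
  ultimately show ?thesis
    using finW by (intro card_inj_on_le) auto
qed

text \<open>The pairs that must be non-edges for every \<open>F i\<close> to be independent.
  \<open>F\<close> is a planted family at first and the list of colour classes of a map
  later.\<close>

definition inner_pairs :: "nat \<Rightarrow> (nat \<Rightarrow> 'a set) \<Rightarrow> 'a set set" where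
  "inner_pairs r F = (\<Union>i<r. nsets (F i) 2)"

text \<open>The vertices of \<open>W\<close> keep the colours below \<open>M\<close>, and each
  \<open>F i\<close> gets one new colour.\<close>

lemma colourable_with_planted_sets:
  assumes S: "S \<subseteq> nsets V 2" and ind: "S \<inter> inner_pairs r F = {}"
    and W: "V - (\<Union>i<r. F i) = W" and colW: "S \<inter> nsets W 2 \<in> colourable_edges W M"
  shows "S \<in> colourable_edges V (r + M)"
proof -
  obtain f where f: "proper_colouring (W, S \<inter> nsets W 2) M f"
    using colW by (auto simp: colourable_edges_def)
  \<comment> \<open>The sets \<open>F i\<close> may overlap here, so some index of a set containing
    the vertex is picked.\<close>
  define c where "c v = (if v \<in> W then f v else M + (SOME i. i < r \<and> v \<in> F i))" for v
  have some: "(SOME i. i < r \<and> v \<in> F i) < r \<and> v \<in> F (SOME i. i < r \<and> v \<in> F i)"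
    if "v \<in> V - W" for v
    by (rule someI_ex) (use that W in blast)
  have f_less: "f v < M" if "v \<in> W" for v
    using f that by (auto simp: proper_colouring_def)
  have "proper_colouring (V, S) (r + M) c"
    unfolding proper_colouring_def fst_conv snd_conv
  proof (intro conjI allI impI)
    show "c ` V \<subseteq> {..<r + M}"
    proof clarify
      fix v assume "v \<in> V"
      then show "c v < r + M"
        using some[of v] f_less[of v] by (auto simp: c_def)
    qed
    fix u v assume uv: "{u, v} \<in> S"
    then have uv': "{u, v} \<in> nsets V 2" using S by blast
    then have "u \<in> V" "v \<in> V" by (auto simp: nsets_def)
    show "c u \<noteq> c v"
    proof
      assume eq: "c u = c v"
      consider "u \<in> W" "v \<in> W" | "u \<in> W" "v \<notin> W" | "u \<notin> W" "v \<in> W" | "u \<notin> W" "v \<notin> W"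
        by blast
      then show False
      proof cases
        case 1
        then have "{u, v} \<in> S \<inter> nsets W 2" using uv uv' by (auto simp: nsets_def)
        then show False using f 1 eq by (auto simp: proper_colouring_def c_def)
      next
        case 4
        define i where "i = (SOME i. i < r \<and> u \<in> F i)"
        have "i < r" "u \<in> F i"
          using some[of u] 4 \<open>u \<in> V\<close> by (auto simp: i_def)
        moreover have "i = (SOME i. i < r \<and> v \<in> F i)"
          using eq 4 by (simp add: c_def i_def)
        then have "v \<in> F i"
          using some[of v] 4 \<open>v \<in> V\<close> by auto
        ultimately have "{u, v} \<in> inner_pairs r F"
          using uv' by (auto simp: inner_pairs_def nsets_def)
        then show False using uv ind by blast
      qed (use eq f_less[of u] f_less[of v] in \<open>auto simp: c_def\<close>)
    qed
  qed
  then show ?thesis using S by (auto simp: colourable_edges_def)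
qed

text \<open>Independence of disjoint groups of pairs: \<open>S\<close> amounts to a member
  \<open>S \<inter> B\<close> of \<open>Q\<close> together with an arbitrary subset of
  \<open>E - A - B\<close>. The powers of two are multiplied out to stay in the natural
  numbers.\<close>

lemma card_avoid_restrict:
  assumes fin: "finite E" and A: "A \<subseteq> E" and B: "B \<subseteq> E" and disj: "A \<inter> B = {}" and Q: "Q \<subseteq> Pow B"
  shows "card {S \<in> Pow E. S \<inter> A = {} \<and> S \<inter> B \<in> Q} * 2 ^ (card A + card B) = 2 ^ card E * card Q"
proof -
  let ?R = "E - A - B"
  have finite: "finite A" "finite B" "finite ?R"
    using fin A B by (auto intro: finite_subset)
  have QB: "(X \<union> Y) \<inter> B = X" if "X \<in> Q" "Y \<subseteq> ?R" for X Y
    using Q that by blast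
  have "{S \<in> Pow E. S \<inter> A = {} \<and> S \<inter> B \<in> Q} = (\<lambda>(X, Y). X \<union> Y) ` (Q \<times> Pow ?R)"
    (is "?L = ?f ` ?P")
  proof (intro equalityI subsetI)
    fix S assume "S \<in> ?L"
    then have "S = ?f (S \<inter> B, S \<inter> ?R)" "(S \<inter> B, S \<inter> ?R) \<in> ?P"
      by auto
    then show "S \<in> ?f ` ?P" by (rule image_eqI)
  next
    fix S assume "S \<in> ?f ` ?P"
    then obtain X Y where XY: "S = X \<union> Y" "X \<in> Q" "Y \<subseteq> ?R" by auto
    then have "X \<subseteq> B" "S \<inter> B = X" using Q QB by auto
    then show "S \<in> ?L" using XY A B disj by auto
  qed
  moreover have "inj_on ?f ?P"
  proof (rule inj_on_inverseI[where g = "\<lambda>S. (S \<inter> B, S \<inter> ?R)"])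
    fix p assume "p \<in> ?P"
    then obtain X Y where XY: "p = (X, Y)" "X \<in> Q" "Y \<subseteq> ?R" by auto
    then have "X \<subseteq> B" "(X \<union> Y) \<inter> B = X" using Q QB by auto
    then have "(X \<union> Y) \<inter> ?R = Y" using XY by auto
    then show "(?f p \<inter> B, ?f p \<inter> ?R) = p" using XY \<open>(X \<union> Y) \<inter> B = X\<close> by simp
  qed
  ultimately have "card ?L = card Q * 2 ^ card ?R"
    by (simp add: card_image card_cartesian_product card_Pow finite)
  moreover have "card E = card A + card B + card ?R"
  proof -
    have "E = A \<union> B \<union> ?R" using A B by blast
    then have "card E = card (A \<union> B \<union> ?R)" by simp
    also have "\<dots> = card A + card B + card ?R"
      using finite disj by (subst card_Un_disjoint; auto simp: card_Un_disjoint)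
    finally show ?thesis .
  qed
  ultimately show ?thesis by (simp add: power_add)
qed

section \<open>The second moment of the number of planted families\<close>

text \<open>The falling factorial k(k-1)...(k-l+1); truncated subtraction makes it zero for
  \<open>l > k\<close>.\<close>

definition falling :: "nat \<Rightarrow> nat \<Rightarrow> nat" where
  "falling k l = (\<Prod>j<l. k - j)"

lemma falling_add_le: "falling k (a + b) \<le> falling k a * falling k b"
proof (induction b)
  case (Suc b)
  have "falling k (a + Suc b) = falling k (a + b) * (k - (a + b))"
    by (simp add: falling_def)
  also have "\<dots> \<le> falling k a * falling k b * (k - b)"
    by (intro mult_mono Suc.IH) auto
  finally show ?case by (simp add: falling_def mult.assoc)
qed (simp add: falling_def)

lemma falling_sum_le: "finite I \<Longrightarrow> falling k (\<Sum>i\<in>I. a i) \<le> (\<Prod>i\<in>I. falling k (a i))"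
proof (induction I rule: finite_induct)
  case (insert i I)
  then show ?case
    using falling_add_le[of k "a i" "sum a I"] by (auto intro: order_trans mult_le_mono2)
qed (simp add: falling_def)

text \<open>\<open>falling k L / falling n L\<close> is the probability that a random
  \<open>k\<close>-subset of an \<open>n\<close>-set contains a given \<open>L\<close>-set; this is
  the same fact without division.\<close>

lemma binomial_falling:
  "L \<le> k \<Longrightarrow> k \<le> n \<Longrightarrow> (n - L choose (k - L)) * falling n L = (n choose k) * falling k L"
proof (induction L)
  case (Suc L)
  have "(n - Suc L choose (k - Suc L)) * (n - L) = (n - L choose (k - L)) * (k - L)"
    using times_binomial_minus1_eq[of "k - L" "n - L"] Suc.prems by (simp add: mult.commute)
  then have "(n - Suc L choose (k - Suc L)) * falling n (Suc L) =
      (n - L choose (k - L)) * falling n L * (k - L)"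
    by (simp add: falling_def mult_ac del: diff_Suc_eq_diff_pred)
  also have "\<dots> = (n choose k) * falling k (Suc L)"
    using Suc by (simp add: falling_def)
  finally show ?case .
qed (simp add: falling_def)

lemma card_supersets_nsets:
  assumes "finite V" "A \<subseteq> V" "card A \<le> k"
  shows "card {T \<in> nsets V k. A \<subseteq> T} = (card V - card A choose (k - card A))"
proof -
  have finA: "finite A" using assms finite_subset by blast
  have "{T \<in> nsets V k. A \<subseteq> T} = (\<union>) A ` nsets (V - A) (k - card A)" (is "?L = ?R")
  proof (intro equalityI subsetI)
    fix T assume T: "T \<in> ?L"
    then have "T = A \<union> (T - A)" "T - A \<in> nsets (V - A) (k - card A)"
      using finA by (auto simp: nsets_def card_Diff_subset)
    then show "T \<in> ?R" by (rule image_eqI)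
  next
    fix T assume "T \<in> ?R"
    then obtain X where X: "T = A \<union> X" "X \<subseteq> V - A" "finite X" "card X = k - card A"
      by (auto simp: nsets_def)
    then have "card T = card A + card X"
      using finA by (subst X(1), intro card_Un_disjoint) auto
    then show "T \<in> ?L" using X assms finA by (auto simp: nsets_def)
  qed
  moreover have "inj_on ((\<union>) A) (nsets (V - A) (k - card A))"
    by (rule inj_on_inverseI[where g = "\<lambda>T. T - A"]) (auto simp: nsets_def)
  ultimately show ?thesis
    using assms finA by (simp add: card_image card_Diff_subset)
qed

text \<open>Each factor of \<open>falling (card V) (card A)\<close> is at least
  \<open>card V - k\<close>. A pure power in the denominator is weaker than the falling factorial
  but splits over disjoint pieces of \<open>A\<close>.\<close>

lemma card_supersets_nsets_le:
  assumes fin: "finite V" and "A \<subseteq> V" and kV: "k < card V"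
  shows "real (card {T \<in> nsets V k. A \<subseteq> T}) \<le>
    card (nsets V k) * (falling k (card A) / real (card V - k) ^ card A)"
proof (cases "card A \<le> k")
  case True
  let ?n = "card V" and ?L = "card A"
  have pos: "real (?n - k) ^ ?L > 0" using kV by simp
  have "(?n - k) ^ ?L = (\<Prod>j<?L. ?n - k)" by simp
  also have "\<dots> \<le> falling ?n ?L"
    unfolding falling_def by (rule prod_mono) (use True in auto)
  finally have "(?n - k) ^ ?L \<le> falling ?n ?L" .
  then have "(?n - ?L choose (k - ?L)) * (?n - k) ^ ?L \<le> (?n choose k) * falling k ?L"
    using binomial_falling[OF True, of ?n] kV by (metis less_imp_le mult_le_mono2)
  then have "real ((?n - ?L choose (k - ?L)) * (?n - k) ^ ?L) \<le> real ((?n choose k) * falling k ?L)"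
    by (rule of_nat_mono)
  then show ?thesis
    using pos fin assms True by (simp add: card_supersets_nsets pos_le_divide_eq)
next
  case False
  have "{T \<in> nsets V k. A \<subseteq> T} = {}"
    using False card_mono by (auto simp: nsets_def)
  then show ?thesis by (simp only: card.empty) simp
qed

section \<open>Overlap of a random \<open>k\<close>-set with a family of disjoint
  \<open>k\<close>-sets\<close>

text \<open>The contribution of a shared set of size \<open>l\<close> to the second moment: the
  choices of that set in a fixed \<open>k\<close>-set, the gain from its pairs being required only
  once, and a bound for the probability that a random \<open>k\<close>-set contains it.\<close>

definition overlap_excess :: "nat \<Rightarrow> nat \<Rightarrow> real" where
  "overlap_excess k m =
     (\<Sum>l = 2..k. real (k choose l) * 2 ^ (l choose 2) * (falling k l / real m ^ l))"

lemma overlap_excess_nonneg: "0 \<le> overlap_excess k m"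
  by (auto simp: overlap_excess_def intro!: sum_nonneg)

lemma sum_Pow_card:
  fixes f :: "nat \<Rightarrow> real"
  assumes "finite F"
  shows "(\<Sum>A\<in>Pow F. f (card A)) = (\<Sum>l\<le>card F. real (card F choose l) * f l)"
proof -
  have "(\<Sum>A\<in>Pow F. f (card A)) = (\<Sum>l\<le>card F. \<Sum>A\<in>{A \<in> Pow F. card A = l}. f (card A))"
    by (rule sum.group[symmetric]) (use assms in \<open>auto intro: card_mono\<close>)
  also have "\<dots> = (\<Sum>l\<le>card F. real (card F choose l) * f l)"
    using assms by (intro sum.cong refl) (simp add: n_subsets)
  finally show ?thesis .
qed

text \<open>Singletons cannot share a pair, so only intersections of size at least two contribute.\<close>

definition pair_weight :: "nat \<Rightarrow> real" where
  "pair_weight l = (if l = 0 then 1 else if l = 1 then 0 else 2 ^ (l choose 2))"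

lemma pair_weight_nonneg: "0 \<le> pair_weight l"
  by (simp add: pair_weight_def)

lemma sum_pair_weight:
  assumes "finite F" "card F = k" "2 \<le> k"
  shows "(\<Sum>A\<in>Pow F. pair_weight (card A) * (falling k (card A) / real m ^ card A)) =
    1 + overlap_excess k m"
proof -
  let ?g = "\<lambda>l. real (k choose l) * (pair_weight l * (falling k l / real m ^ l))"
  have "{..k} = insert 0 (insert 1 {2..k})" using assms(3) by auto
  then have "(\<Sum>l\<le>k. ?g l) = ?g 0 + ?g 1 + (\<Sum>l = 2..k. ?g l)" by simp
  also have "?g 0 = 1" by (simp add: pair_weight_def falling_def)
  also have "?g 1 = 0" by (simp add: pair_weight_def)
  also have "(\<Sum>l = 2..k. ?g l) = overlap_excess k m"
    unfolding overlap_excess_def by (rule sum.cong) (auto simp: pair_weight_def)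
  finally show ?thesis
    using sum_Pow_card[OF assms(1), of "\<lambda>l. pair_weight l * (falling k l / real m ^ l)"] assms(2)
    by simp
qed

text \<open>The sum of nonnegative terms dominates the one for \<open>A = X\<close>, the
  intersection itself or the empty set if at most one vertex is shared. Exact intersections are thus
  replaced by events \<open>A \<subseteq> T\<close>, whose probability is under control.\<close>

lemma two_power_pairs_le:
  assumes "finite F"
  shows "2 ^ (card (F \<inter> T) choose 2) \<le> (\<Sum>A\<in>Pow F. pair_weight (card A) * of_bool (A \<subseteq> T))"
proof -
  define X where "X = (if card (F \<inter> T) \<le> 1 then {} else F \<inter> T)"
  have "2 ^ (card (F \<inter> T) choose 2) = pair_weight (card X) * of_bool (X \<subseteq> T)"
    by (auto simp: X_def pair_weight_def le_Suc_eq binomial_eq_0)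
  also have "\<dots> \<le> (\<Sum>A\<in>Pow F. pair_weight (card A) * of_bool (A \<subseteq> T))"
    by (rule member_le_sum) (use assms pair_weight_nonneg in \<open>auto simp: X_def\<close>)
  finally show ?thesis .
qed

text \<open>Multiplying out the bounds of \<open>two_power_pairs_le\<close>, a choice of
  \<open>A i\<close> inside each \<open>F i\<close> counts only those \<open>T\<close> that contain
  the union. The \<open>A i\<close> are disjoint, so the bound for the number of such
  \<open>T\<close> is a product over \<open>i\<close>, and each factor sums to
  \<open>1 + overlap_excess\<close>.\<close>

lemma sum_overlap_le:
  fixes F :: "nat \<Rightarrow> 'a set"
  assumes V: "finite V" and kV: "2 \<le> k" "k < card V"
    and F: "\<And>i. i < r \<Longrightarrow> F i \<in> nsets V k" and disj: "disjoint_family_on F {..<r}"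
  shows "(\<Sum>T\<in>nsets V k. \<Prod>i<r. 2 ^ (card (F i \<inter> T) choose 2)) \<le>
    card (nsets V k) * (1 + overlap_excess k (card V - k)) ^ r"
proof -
  let ?K = "nsets V k"
  let ?v = "\<lambda>l. falling k l / real (card V - k) ^ l"
  have finF: "finite (F i)" "F i \<subseteq> V" "card (F i) = k" if "i < r" for i
    using F[OF that] by (auto simp: nsets_def)
  let ?P = "PiE {..<r} (\<lambda>i. Pow (F i))"
  have finP: "finite ?P" using finF by (intro finite_PiE) auto
  have "(\<Prod>i<r. 2 ^ (card (F i \<inter> T) choose 2)) \<le>
      (\<Sum>A\<in>?P. (\<Prod>i<r. pair_weight (card (A i))) * of_bool ((\<Union>i<r. A i) \<subseteq> T))" (is "_ \<le> ?rhs T") for T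
  proof -
    have "(\<Prod>i<r. 2 ^ (card (F i \<inter> T) choose 2)) \<le>
        (\<Prod>i<r. \<Sum>A\<in>Pow (F i). pair_weight (card A) * of_bool (A \<subseteq> T))"
      by (intro prod_mono conjI two_power_pairs_le) (use finF in auto)
    also have "\<dots> = (\<Sum>A\<in>?P. \<Prod>i<r. pair_weight (card (A i)) * of_bool (A i \<subseteq> T))"
      by (intro prod_sum_PiE) (use finF in auto)
    also have "\<dots> = ?rhs T"
    proof (rule sum.cong[OF refl])
      fix A
      have "(\<Prod>i<r. of_bool (A i \<subseteq> T)) = (of_bool ((\<Union>i<r. A i) \<subseteq> T) :: real)"
        by (induction r) (auto simp: lessThan_Suc)
      then show "(\<Prod>i<r. pair_weight (card (A i)) * of_bool (A i \<subseteq> T)) =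
          (\<Prod>i<r. pair_weight (card (A i))) * of_bool ((\<Union>i<r. A i) \<subseteq> T)"
        by (simp add: prod.distrib)
    qed
    finally show ?thesis .
  qed
  then have "(\<Sum>T\<in>?K. \<Prod>i<r. 2 ^ (card (F i \<inter> T) choose 2)) \<le> (\<Sum>T\<in>?K. ?rhs T)"
    by (intro sum_mono)
  also have "\<dots> = (\<Sum>A\<in>?P. (\<Prod>i<r. pair_weight (card (A i))) * card {T \<in> ?K. (\<Union>i<r. A i) \<subseteq> T})"
  proof (subst sum.swap, rule sum.cong[OF refl])
    fix A
    have "(\<Sum>T\<in>?K. of_bool ((\<Union>i<r. A i) \<subseteq> T)) = real (card {T \<in> ?K. (\<Union>i<r. A i) \<subseteq> T})"
      using V by (simp add: finite_imp_finite_nsets Int_def)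
    then show "(\<Sum>T\<in>?K. (\<Prod>i<r. pair_weight (card (A i))) * of_bool ((\<Union>i<r. A i) \<subseteq> T)) =
        (\<Prod>i<r. pair_weight (card (A i))) * card {T \<in> ?K. (\<Union>i<r. A i) \<subseteq> T}"
      by (simp only: sum_distrib_left[symmetric])
  qed
  also have "\<dots> \<le> (\<Sum>A\<in>?P. (\<Prod>i<r. pair_weight (card (A i))) * (card ?K * (\<Prod>i<r. ?v (card (A i)))))"
  proof (intro sum_mono mult_left_mono prod_nonneg ballI pair_weight_nonneg)
    fix A assume A: "A \<in> ?P"
    let ?U = "\<Union>i<r. A i"
    have sub: "A i \<subseteq> F i" if "i < r" for i using A that by auto
    have "card ?U = (\<Sum>i<r. card (A i))"
    proof (rule card_UN_disjoint)
      show "\<forall>i\<in>{..<r}. finite (A i)" using sub finF by (auto intro: finite_subset)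
      show "\<forall>i\<in>{..<r}. \<forall>j\<in>{..<r}. i \<noteq> j \<longrightarrow> A i \<inter> A j = {}"
        using sub disj unfolding disjoint_family_on_def by blast
    qed simp
    \<comment> \<open>The exponents add up exactly by disjointness, while \<open>falling\<close> is
      only submultiplicative, which is the direction required.\<close>
    then have "real (falling k (card ?U)) / real (card V - k) ^ card ?U \<le>
        real (\<Prod>i<r. falling k (card (A i))) / real (card V - k) ^ (\<Sum>i<r. card (A i))"
      by (auto intro!: divide_right_mono falling_sum_le of_nat_mono simp del: of_nat_prod)
    also have "\<dots> = (\<Prod>i<r. ?v (card (A i)))"
      by (simp add: prod_dividef power_sum)
    finally have "real (card ?K) * ?v (card ?U) \<le> card ?K * (\<Prod>i<r. ?v (card (A i)))"
      by (intro mult_left_mono) auto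
    moreover have "?U \<subseteq> V" using sub finF by blast
    ultimately show "real (card {T \<in> ?K. ?U \<subseteq> T}) \<le> card ?K * (\<Prod>i<r. ?v (card (A i)))"
      using card_supersets_nsets_le[OF V _ kV(2), of ?U] by linarith
  qed
  also have "\<dots> = card ?K * (\<Sum>A\<in>?P. \<Prod>i<r. pair_weight (card (A i)) * ?v (card (A i)))"
    by (simp only: sum_distrib_left prod.distrib mult.left_commute)
  also have "(\<Sum>A\<in>?P. \<Prod>i<r. pair_weight (card (A i)) * ?v (card (A i))) =
      (\<Prod>i<r. \<Sum>A\<in>Pow (F i). pair_weight (card A) * ?v (card A))"
    by (intro prod_sum_PiE[symmetric]) (use finF in auto)
  also have "\<dots> = (\<Prod>i<r. 1 + overlap_excess k (card V - k))"
    by (intro prod.cong refl sum_pair_weight) (use finF kV in auto)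
  finally show ?thesis by simp
qed

section \<open>Counting families of disjoint \<open>k\<close>-sets\<close>

text \<open>Families are ordered tuples, so that they sit inside the full product of
  \<open>r\<close> copies of \<open>nsets V k\<close>, where sums factorise.\<close>

definition disjoint_sets :: "'a set \<Rightarrow> nat \<Rightarrow> nat \<Rightarrow> (nat \<Rightarrow> 'a set) set" where
  "disjoint_sets V r k =
     {F \<in> PiE {..<r} (\<lambda>_. nsets V k). disjoint_family_on F {..<r}}"

lemma finite_disjoint_sets: "finite V \<Longrightarrow> finite (disjoint_sets V r k)"
  by (rule finite_subset[of _ "PiE {..<r} (\<lambda>_. nsets V k)"])
    (auto simp: disjoint_sets_def finite_imp_finite_nsets intro!: finite_PiE)

lemma disjoint_sets_0: "disjoint_sets V 0 k = {\<lambda>_. undefined}"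
  by (auto simp: disjoint_sets_def disjoint_family_on_def)

lemma disjoint_setsD:
  assumes "F \<in> disjoint_sets V r k"
  shows "i < r \<Longrightarrow> F i \<in> nsets V k" "disjoint_family_on F {..<r}"
  using assms by (auto simp: disjoint_sets_def)

lemma card_Union_disjoint_sets:
  assumes F: "F \<in> disjoint_sets V r k"
  shows "card (\<Union>i<r. F i) = r * k"
proof -
  have "card (\<Union>i<r. F i) = (\<Sum>i<r. card (F i))"
    by (rule card_UN_disjoint)
      (use disjoint_setsD[OF F] in \<open>auto simp: nsets_def disjoint_family_on_def\<close>)
  also have "\<dots> = (\<Sum>i<r. k)"
    by (rule sum.cong) (use disjoint_setsD[OF F] in \<open>auto simp: nsets_def\<close>)
  finally show ?thesis by simp
qed

text \<open>The sets are chosen one after another, each outside the union of the previous ones;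
  \<open>F(r := T)\<close> encodes the extended tuple injectively.\<close>

lemma card_disjoint_sets_ge:
  assumes "finite V"
  shows "(\<Prod>j<r. card V - j * k choose k) \<le> card (disjoint_sets V r k)"
proof (induction r)
  case (Suc r)
  let ?X = "SIGMA F:disjoint_sets V r k. nsets (V - (\<Union>i<r. F i)) k"
  let ?f = "\<lambda>(F, T). F(r := T)"
  have "inj_on ?f ?X"
  proof (rule inj_onI, clarify)
    fix F T F' T'
    assume F: "F \<in> disjoint_sets V r k" and F': "F' \<in> disjoint_sets V r k"
      and eq: "F(r := T) = F'(r := T')"
    have "F i = F' i" for i
    proof (cases "i = r")
      case True
      then show ?thesis using F F' by (auto simp: disjoint_sets_def PiE_def extensional_def)
    next
      case False
      then show ?thesis using fun_cong[OF eq, of i] by simp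
    qed
    moreover have "T = T'" using fun_cong[OF eq, of r] by simp
    ultimately show "F = F' \<and> T = T'" by blast
  qed
  moreover have "?f ` ?X \<subseteq> disjoint_sets V (Suc r) k"
  proof clarify
    fix F T assume F: "F \<in> disjoint_sets V r k" and T: "T \<in> nsets (V - (\<Union>i<r. F i)) k"
    have TV: "T \<in> nsets V k" and disjT: "\<And>i. i < r \<Longrightarrow> T \<inter> F i = {}"
      using T by (auto simp: nsets_def)
    have "F(r := T) \<in> PiE {..<Suc r} (\<lambda>_. nsets V k)"
      using F TV by (auto simp: disjoint_sets_def PiE_def extensional_def less_Suc_eq)
    moreover have "disjoint_family_on (F(r := T)) {..<Suc r}"
      unfolding disjoint_family_on_def
    proof (intro ballI impI)
      fix i j assume ij: "i \<in> {..<Suc r}" "j \<in> {..<Suc r}" "i \<noteq> j"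
      then consider "i = r" "j < r" | "j = r" "i < r" | "i < r" "j < r" by fastforce
      then show "(F(r := T)) i \<inter> (F(r := T)) j = {}"
      proof cases
        case 3
        then show ?thesis using disjoint_setsD(2)[OF F] ij by (simp add: disjoint_family_on_def)
      qed (use disjT in \<open>auto simp: Int_commute\<close>)
    qed
    ultimately show "F(r := T) \<in> disjoint_sets V (Suc r) k"
      by (simp add: disjoint_sets_def)
  qed
  ultimately have "card ?X \<le> card (disjoint_sets V (Suc r) k)"
    using assms by (intro card_inj_on_le[of ?f]) (auto simp: finite_disjoint_sets)
  moreover have "card ?X = card (disjoint_sets V r k) * (card V - r * k choose k)"
  proof -
    have "card (nsets (V - (\<Union>i<r. F i)) k) = (card V - r * k choose k)"
      if F: "F \<in> disjoint_sets V r k" for F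
    proof -
      have sub: "(\<Union>i<r. F i) \<subseteq> V" using disjoint_setsD[OF F] by (auto simp: nsets_def)
      then have "card (V - (\<Union>i<r. F i)) = card V - r * k"
        using assms card_Union_disjoint_sets[OF F] by (metis card_Diff_subset finite_subset)
      then show ?thesis by simp
    qed
    then show ?thesis
      using assms by (simp add: finite_disjoint_sets finite_imp_finite_nsets)
  qed
  ultimately show ?case
    using Suc.IH by (auto intro: order_trans mult_le_mono1)
qed (simp add: disjoint_sets_0)

text \<open>Comparison factor by factor: for \<open>i < k\<close> one has
  \<open>(n - i) * (1 - s / n) \<le> n - s \<le> n - m - i\<close>.\<close>

lemma binomial_diff_ge:
  assumes "m + k \<le> s" "s \<le> n"
  shows "real (n choose k) * (1 - real s / real n) ^ k \<le> real (n - m choose k)"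
proof (cases "n = 0")
  case False
  have "real (n choose k) * (1 - real s / real n) ^ k =
      (\<Prod>i<k. real (n - i) / real (k - i) * (1 - real s / real n))"
    using assms by (simp add: binomial_altdef_of_nat prod.distrib prod_dividef atLeast0LessThan)
  also have "\<dots> \<le> (\<Prod>i<k. real (n - m - i) / real (k - i))"
  proof (rule prod_mono, intro conjI)
    fix i assume i: "i \<in> {..<k}"
    have s: "0 \<le> 1 - real s / real n" using assms False by simp
    then show "0 \<le> real (n - i) / real (k - i) * (1 - real s / real n)" by simp
    have "real (n - i) * (1 - real s / real n) \<le> n * (1 - real s / real n)"
      using s by (intro mult_right_mono) auto
    also have "\<dots> = real n - s" using False by (simp add: algebra_simps)
    also have "\<dots> \<le> real (n - m - i)" using assms i by simp
    finally have "real (n - i) * (1 - real s / real n) / real (k - i) \<le> real (n - m - i) / real (k - i)"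
      by (rule divide_right_mono) simp
    then show "real (n - i) / real (k - i) * (1 - real s / real n) \<le> real (n - m - i) / real (k - i)"
      by simp
  qed
  also have "\<dots> = real (n - m choose k)"
    using assms by (subst binomial_altdef_of_nat) (auto simp: atLeast0LessThan)
  finally show ?thesis .
qed (use assms in auto)

text \<open>\<open>r\<close> independent random \<open>k\<close>-sets are disjoint with probability
  at least \<open>(1 - r * k / n) ^ (r * k)\<close>, which by Bernoulli's inequality is at least
  \<open>1 - (r * k)\<^sup>2 / n\<close> and so at least 1/2.\<close>

lemma card_disjoint_sets_ge_half:
  assumes V: "finite V" "card V = n" and n: "2 * (r * k)\<^sup>2 \<le> n"
  shows "real (card (nsets V k)) ^ r / 2 \<le> card (disjoint_sets V r k)"
proof (cases "r * k = 0")
  case True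
  then consider "r = 0" | "k = 0" by fastforce
  then show ?thesis
  proof cases
    case 1
    then show ?thesis by (simp add: disjoint_sets_0)
  next
    case 2
    then have "real (\<Prod>j<r. card V - j * k choose k) \<le> real (card (disjoint_sets V r k))"
      by (intro of_nat_mono card_disjoint_sets_ge V)
    then show ?thesis using 2 V by simp
  qed
next
  case False
  have "r * k \<le> (r * k)\<^sup>2" by (simp add: power2_eq_square)
  then have rk: "r * k \<le> n" "0 < n" using n False by linarith+
  let ?x = "real (r * k) / real n"
  have x: "?x \<le> 1" using of_nat_mono[OF rk(1), where 'a = real] rk(2) by simp
  have "real (r * k) * ?x \<le> 1 / 2"
  proof -
    have "2 * (real (r * k))\<^sup>2 \<le> real n" using of_nat_mono[OF n, where 'a = real] by simp
    then show ?thesis using rk by (simp add: field_simps power2_eq_square)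
  qed
  then have "1 / 2 \<le> 1 + real (k * r) * (- ?x)"
    unfolding mult.commute[of r k] by linarith
  also have "\<dots> \<le> (1 + - ?x) ^ (k * r)"
    by (rule Bernoulli_inequality) (use x in auto)
  finally have half: "1 / 2 \<le> (1 - ?x) ^ (k * r)" by simp
  have "real (card (nsets V k)) ^ r * (1 / 2) \<le> real (n choose k) ^ r * (1 - ?x) ^ (k * r)"
    unfolding card_nsets V(2) by (rule mult_left_mono[OF half]) simp
  also have "\<dots> = (\<Prod>j<r. real (n choose k) * (1 - ?x) ^ k)"
    by (simp add: power_mult power_mult_distrib)
  also have "\<dots> \<le> (\<Prod>j<r. real (n - j * k choose k))"
  proof (rule prod_mono, intro conjI binomial_diff_ge)
    fix j assume "j \<in> {..<r}"
    then have "Suc j * k \<le> r * k" by (intro mult_le_mono1) auto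
    then show "j * k + k \<le> r * k" by simp
    show "0 \<le> real (n choose k) * (1 - ?x) ^ k" using x by simp
  qed (use rk in auto)
  also have "\<dots> \<le> card (disjoint_sets V r k)"
    using of_nat_mono[OF card_disjoint_sets_ge[OF V(1), of k r], where 'a = real] V by simp
  finally show ?thesis by simp
qed

section \<open>Pairs shared by two families, and the second moment inequality\<close>

lemma nsets_2_disjoint:
  assumes "A \<inter> B = {}"
  shows "nsets A 2 \<inter> nsets B 2 = {}"
proof (rule equals0I)
  fix e assume "e \<in> nsets A 2 \<inter> nsets B 2"
  then have "e \<subseteq> A \<inter> B" "card e = 2" by (auto simp: nsets_def)
  then show False using assms by auto
qed

lemma card_inner_pairs_disjoint:
  assumes "disjoint_family_on F {..<r}" "\<And>i. i < r \<Longrightarrow> finite (F i)"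
  shows "card (inner_pairs r F) = (\<Sum>i<r. card (F i) choose 2)"
proof -
  have "card (inner_pairs r F) = (\<Sum>i<r. card (nsets (F i) 2))"
    unfolding inner_pairs_def
  proof (rule card_UN_disjoint)
    show "\<forall>i\<in>{..<r}. finite (nsets (F i) 2)"
      using assms by (auto intro: finite_imp_finite_nsets)
    show "\<forall>i\<in>{..<r}. \<forall>j\<in>{..<r}. i \<noteq> j \<longrightarrow> nsets (F i) 2 \<inter> nsets (F j) 2 = {}"
      using assms by (auto simp: disjoint_family_on_def intro!: nsets_2_disjoint)
  qed simp
  then show ?thesis by simp
qed

lemma card_inner_pairs:
  assumes F: "F \<in> disjoint_sets V r k"
  shows "card (inner_pairs r F) = r * (k choose 2)"
proof -
  have "finite (F i)" "card (F i) = k" if "i < r" for i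
    using disjoint_setsD(1)[OF F that] by (auto simp: nsets_def)
  then show ?thesis
    using disjoint_setsD(2)[OF F] by (simp add: card_inner_pairs_disjoint)
qed

text \<open>A shared pair lies in some \<open>F i \<inter> F' j\<close>. The union bound asks no
  disjointness of \<open>F'\<close>, so \<open>F'\<close> can range over all tuples.\<close>

lemma card_inner_pairs_Int_le:
  assumes F: "F \<in> disjoint_sets V r k" and F': "F' \<in> PiE {..<r} (\<lambda>_. nsets V k)"
  shows "card (inner_pairs r F \<inter> inner_pairs r F') \<le>
    (\<Sum>j<r. \<Sum>i<r. card (F i \<inter> F' j) choose 2)"
proof -
  have "inner_pairs r F \<inter> inner_pairs r F' = (\<Union>j<r. \<Union>i<r. nsets (F i \<inter> F' j) 2)"
    unfolding inner_pairs_def nsets_def by blast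
  also have "card \<dots> \<le> (\<Sum>j<r. card (\<Union>i<r. nsets (F i \<inter> F' j) 2))"
    by (rule card_UN_le) simp
  also have "\<dots> \<le> (\<Sum>j<r. \<Sum>i<r. card (nsets (F i \<inter> F' j) 2))"
    by (intro sum_mono card_UN_le) simp
  finally show ?thesis by simp
qed

text \<open>
  The second family may be enlarged to an arbitrary \<open>r\<close>-tuple of \<open>k\<close>-sets; its members are then
  independent and the sum factorises.
\<close>

lemma sum_inner_pairs_Int_le:
  assumes V: "finite V" and k: "2 \<le> k" "k < card V" and F: "F \<in> disjoint_sets V r k"
  shows "(\<Sum>F'\<in>disjoint_sets V r k. 2 ^ card (inner_pairs r F \<inter> inner_pairs r F')) \<le>
    (real (card (nsets V k)) * (1 + overlap_excess k (card V - k)) ^ r) ^ r"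
proof -
  let ?P = "PiE {..<r} (\<lambda>_. nsets V k)"
  have fin: "finite (nsets V k)" using V by (rule finite_imp_finite_nsets)
  have "(\<Sum>F'\<in>disjoint_sets V r k. 2 ^ card (inner_pairs r F \<inter> inner_pairs r F')) \<le>
      (\<Sum>F'\<in>?P. 2 ^ card (inner_pairs r F \<inter> inner_pairs r F') :: real)"
    by (rule sum_mono2) (use fin in \<open>auto simp: disjoint_sets_def intro!: finite_PiE\<close>)
  also have "\<dots> \<le> (\<Sum>F'\<in>?P. \<Prod>j<r. \<Prod>i<r. 2 ^ (card (F i \<inter> F' j) choose 2))"
  proof (rule sum_mono)
    fix F' assume "F' \<in> ?P"
    then have "(2::real) ^ card (inner_pairs r F \<inter> inner_pairs r F') \<le>
        2 ^ (\<Sum>j<r. \<Sum>i<r. card (F i \<inter> F' j) choose 2)"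
      using card_inner_pairs_Int_le[OF F] by (intro power_increasing) auto
    then show "2 ^ card (inner_pairs r F \<inter> inner_pairs r F') \<le>
        (\<Prod>j<r. \<Prod>i<r. (2::real) ^ (card (F i \<inter> F' j) choose 2))"
      by (simp add: power_sum)
  qed
  also have "\<dots> = (\<Prod>j<r. \<Sum>T\<in>nsets V k. \<Prod>i<r. 2 ^ (card (F i \<inter> T) choose 2))"
    by (rule prod_sum_PiE[symmetric]) (use fin in auto)
  also have "\<dots> \<le> (\<Prod>j<r. real (card (nsets V k)) * (1 + overlap_excess k (card V - k)) ^ r)"
    by (intro prod_mono conjI sum_nonneg prod_nonneg sum_overlap_le V k disjoint_setsD[OF F]) auto
  finally show ?thesis by simp
qed

lemma card_subsets_avoiding:
  assumes "finite E" "A \<subseteq> E"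
  shows "real (card {S \<in> Pow E. S \<inter> A = {}}) = 2 ^ card E / 2 ^ card A"
proof -
  have "{S \<in> Pow E. S \<inter> A = {}} = Pow (E - A)" by auto
  then have "real (card {S \<in> Pow E. S \<inter> A = {}}) = 2 ^ card (E - A)"
    using assms by (simp only: card_Pow finite_Diff of_nat_power) simp
  moreover have "card E = card (E - A) + card A"
    using assms by (metis card_Diff_subset card_mono finite_subset le_add_diff_inverse2)
  ultimately show ?thesis by (simp add: power_add)
qed

text \<open>Let \<open>Z S\<close> be the number of planted families that are independent in
  \<open>S\<close>. Cauchy-Schwarz over the colourable edge sets bounds their number below by the
  square of their share of the first moment of \<open>Z\<close>, divided by the second moment. A
  constant loss is harmless because it is played against an event of probability near one.\<close>

lemma planted_second_moment:
  fixes n r k M :: nat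
  assumes k: "2 \<le> k" "1 \<le> r" and n: "2 * (r * k)\<^sup>2 \<le> n + r * k"
    and exc: "(real r)\<^sup>2 * overlap_excess k (n + r * k - k) \<le> 1"
  shows "(measure_pmf.prob (binomial_random_graph n (1/2)) {G. chromatic_number G \<le> M})\<^sup>2 / 6 \<le>
    measure_pmf.prob (binomial_random_graph (n + r * k) (1/2)) {G. chromatic_number G \<le> r + M}"
proof -
  define V where "V = {..<n + r * k}"
  define E where "E = nsets V 2"
  define D where "D = disjoint_sets V r k"
  \<comment> \<open>\<open>p\<close> and \<open>q\<close> are the two probabilities of the claim,
    and \<open>1 / Q\<close> is the probability that a given family is independent.\<close>
  define p where "p = card (colourable_edges {..<n} M) / 2 ^ (n choose 2)"
  define q where "q = card (colourable_edges V (r + M)) / 2 ^ card E"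
  define \<omega> where "\<omega> = overlap_excess k (n + r * k - k)"
  define Q :: real where "Q = 2 ^ (r * (k choose 2))"
  define Z where "Z S = (\<Sum>F\<in>D. of_bool (S \<inter> inner_pairs r F = {}) :: real)" for S
  have V: "finite V" "card V = n + r * k" by (auto simp: V_def)
  have E: "finite E" "card E = (n + r * k) choose 2"
    using V by (auto simp: E_def finite_imp_finite_nsets)
  have finD: "finite D" using V by (simp add: D_def finite_disjoint_sets)
  have Q: "Q > 0" by (simp add: Q_def)
  have colE: "colourable_edges V (r + M) \<subseteq> Pow E" by (auto simp: colourable_edges_def E_def)
  have kV: "k < card V"
  proof -
    have "k \<le> r * k" using k by simp
    then have "k * 2 \<le> (r * k) * (r * k)" using k mult_le_mono[of 1 r 2 k] by (intro mult_le_mono) auto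
    then have "k * 2 \<le> n + r * k" using n unfolding power2_eq_square by linarith
    then show ?thesis using k V by linarith
  qed
  have inner: "inner_pairs r F \<subseteq> E" "card (inner_pairs r F) = r * (k choose 2)" if "F \<in> D" for F
  proof -
    show "inner_pairs r F \<subseteq> E"
      unfolding inner_pairs_def E_def
    proof (intro UN_least nsets_mono)
      fix i assume "i \<in> {..<r}"
      then show "F i \<subseteq> V" using that disjoint_setsD(1)[of F V r k i] by (auto simp: D_def nsets_def)
    qed
    show "card (inner_pairs r F) = r * (k choose 2)"
      using that card_inner_pairs by (auto simp: D_def)
  qed

  \<comment> \<open>Once a family is required to be independent, the graph on the other
    \<open>n\<close> vertices is still uniform, hence \<open>M\<close>-colourable with probability
    at least \<open>p\<close>.\<close>
  have lower: "card D * (2 ^ card E * p / Q) \<le> (\<Sum>S\<in>colourable_edges V (r + M). Z S)"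
  proof -
    have "2 ^ card E * p / Q \<le> (\<Sum>S\<in>colourable_edges V (r + M). of_bool (S \<inter> inner_pairs r F = {}))" if F: "F \<in> D" for F
    proof -
      define W where "W = V - (\<Union>i<r. F i)"
      let ?B = "nsets W 2"
      let ?X = "{S \<in> Pow E. S \<inter> inner_pairs r F = {} \<and> S \<inter> ?B \<in> colourable_edges W M}"
      have FD: "F \<in> disjoint_sets V r k" using F by (simp add: D_def)
      have sub: "(\<Union>i<r. F i) \<subseteq> V" using disjoint_setsD[OF FD] by (auto simp: nsets_def)
      then have W: "finite W" "card W = n"
        using V card_Union_disjoint_sets[OF FD] by (auto simp: W_def card_Diff_subset finite_subset)
      then obtain g where "bij_betw g {..<n} W"
        by (metis bij_betw_iff_card card_lessThan finite_lessThan)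
      then have "card (colourable_edges {..<n} M) \<le> card (colourable_edges W M)" by (rule card_colourable_edges_le) simp
      then have "p * 2 ^ (n choose 2) \<le> card (colourable_edges W M)"
        by (simp add: p_def)
      moreover have "card ?X * 2 ^ (card (inner_pairs r F) + card ?B) = 2 ^ card E * card (colourable_edges W M)"
      proof (rule card_avoid_restrict[OF E(1) inner(1)[OF F]])
        show "?B \<subseteq> E" by (auto simp: E_def W_def nsets_def)
        have "nsets (F i) 2 \<inter> ?B = {}" if "i < r" for i
          using that by (intro nsets_2_disjoint) (auto simp: W_def)
        then show "inner_pairs r F \<inter> ?B = {}" unfolding inner_pairs_def by blast
        show "colourable_edges W M \<subseteq> Pow ?B" by (auto simp: colourable_edges_def)
      qed
      then have "real (card ?X) * (Q * 2 ^ (n choose 2)) = 2 ^ card E * card (colourable_edges W M)"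
        using arg_cong[of _ _ real] W by (fastforce simp: inner(2)[OF F] Q_def power_add)
      ultimately have "2 ^ card E * (p * 2 ^ (n choose 2)) \<le> real (card ?X) * (Q * 2 ^ (n choose 2))"
        by simp
      then have "2 ^ card E * p / Q \<le> card ?X"
        using Q by (simp add: field_simps)
      also have "card ?X \<le> card (colourable_edges V (r + M) \<inter> {S. S \<inter> inner_pairs r F = {}})"
      proof (rule card_mono)
        show "finite (colourable_edges V (r + M) \<inter> {S. S \<inter> inner_pairs r F = {}})" using V by simp
        show "?X \<subseteq> colourable_edges V (r + M) \<inter> {S. S \<inter> inner_pairs r F = {}}"
          using colourable_with_planted_sets[of _ V r F W M] by (auto simp: E_def W_def)
      qed
      finally show ?thesis using V by (simp add: of_bool_def sum.If_cases)
    qed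
    then have "(\<Sum>F\<in>D. 2 ^ card E * p / Q) \<le>
        (\<Sum>F\<in>D. \<Sum>S\<in>colourable_edges V (r + M). of_bool (S \<inter> inner_pairs r F = {}))"
      by (rule sum_mono)
    then show ?thesis by (simp add: Z_def sum.swap[of _ D])
  qed

  \<comment> \<open>Two families are both independent with probability
    \<open>2 ^ s / Q\<^sup>2\<close>, where \<open>s\<close> is the number of pairs they
    share.\<close>
  have second: "(\<Sum>S\<in>Pow E. (Z S)\<^sup>2) \<le>
      card D * (2 ^ card E / Q\<^sup>2 * (real (card (nsets V k)) * (1 + \<omega>) ^ r) ^ r)"
  proof -
    have "(\<Sum>S\<in>Pow E. (Z S)\<^sup>2) = (\<Sum>S\<in>Pow E. \<Sum>F\<in>D. \<Sum>F'\<in>D.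
        of_bool (S \<inter> (inner_pairs r F \<union> inner_pairs r F') = {}))"
      unfolding Z_def power2_eq_square sum_product
      by (intro sum.cong refl) auto
    also have "\<dots> = (\<Sum>F\<in>D. \<Sum>F'\<in>D. \<Sum>S\<in>Pow E.
        of_bool (S \<inter> (inner_pairs r F \<union> inner_pairs r F') = {}))"
      by (subst sum.swap, rule sum.cong[OF refl], rule sum.swap)
    also have "\<dots> = (\<Sum>F\<in>D. \<Sum>F'\<in>D. 2 ^ card E / Q\<^sup>2 * 2 ^ card (inner_pairs r F \<inter> inner_pairs r F'))"
    proof (intro sum.cong refl)
      fix F F' assume F: "F \<in> D" and F': "F' \<in> D"
      let ?A = "inner_pairs r F" and ?A' = "inner_pairs r F'"
      have fin: "finite ?A" "finite ?A'" using inner F F' E finite_subset by blast+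
      have "(\<Sum>S\<in>Pow E. of_bool (S \<inter> (?A \<union> ?A') = {})) = real (card {S \<in> Pow E. S \<inter> (?A \<union> ?A') = {}})"
        using E by (simp add: of_bool_def sum.If_cases Int_def)
      also have "\<dots> = 2 ^ card E / 2 ^ card (?A \<union> ?A')"
        using inner F F' E by (intro card_subsets_avoiding) auto
      also have "2 ^ card (?A \<union> ?A') * 2 ^ card (?A \<inter> ?A') = Q\<^sup>2"
        using card_Un_Int[OF fin] inner F F'
        by (simp add: Q_def power_add[symmetric] power2_eq_square)
      then have "(2::real) ^ card E / 2 ^ card (?A \<union> ?A') = 2 ^ card E / Q\<^sup>2 * 2 ^ card (?A \<inter> ?A')"
        using Q by (simp add: field_simps)
      finally show "(\<Sum>S\<in>Pow E. of_bool (S \<inter> (?A \<union> ?A') = {})) =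
          2 ^ card E / Q\<^sup>2 * 2 ^ card (?A \<inter> ?A')" .
    qed
    also have "\<dots> \<le> (\<Sum>F\<in>D. 2 ^ card E / Q\<^sup>2 * (real (card (nsets V k)) * (1 + \<omega>) ^ r) ^ r)"
      unfolding sum_distrib_left[symmetric]
    proof (intro sum_mono mult_left_mono)
      fix F assume "F \<in> D"
      then show "(\<Sum>F'\<in>D. 2 ^ card (inner_pairs r F \<inter> inner_pairs r F')) \<le>
          (real (card (nsets V k)) * (1 + \<omega>) ^ r) ^ r"
        using sum_inner_pairs_Int_le[OF V(1) k(1) kV] by (simp add: D_def \<omega>_def V(2))
    qed auto
    finally show ?thesis by simp
  qed

  \<comment> \<open>Cauchy-Schwarz against the constant 1; then the sum of squares is extended to
    all edge sets.\<close>
  have "(card D * (2 ^ card E * p / Q))\<^sup>2 \<le> (\<Sum>S\<in>colourable_edges V (r + M). Z S)\<^sup>2"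
    by (rule power_mono[OF lower]) (use Q in \<open>auto simp: p_def\<close>)
  also have "\<dots> = (\<Sum>S\<in>colourable_edges V (r + M). 1 * Z S)\<^sup>2" by simp
  also have "\<dots> \<le> (\<Sum>S\<in>colourable_edges V (r + M). 1\<^sup>2) * (\<Sum>S\<in>colourable_edges V (r + M). (Z S)\<^sup>2)"
    by (rule Cauchy_Schwarz_ineq_sum)
  also have "\<dots> \<le> (q * 2 ^ card E) * (\<Sum>S\<in>Pow E. (Z S)\<^sup>2)"
    using colE E by (auto simp: q_def intro!: mult_left_mono sum_mono2)
  also have "\<dots> \<le> (q * 2 ^ card E) *
      (card D * (2 ^ card E / Q\<^sup>2 * (real (card (nsets V k)) * (1 + \<omega>) ^ r) ^ r))"
    by (rule mult_left_mono[OF second]) (simp add: q_def)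
  finally have "(2 ^ card E / Q)\<^sup>2 * ((real (card D))\<^sup>2 * p\<^sup>2) \<le>
      (2 ^ card E / Q)\<^sup>2 * (q * card D * (real (card (nsets V k)) * (1 + \<omega>) ^ r) ^ r)"
    by (simp add: power_mult_distrib power_divide power2_eq_square mult_ac del: card_nsets)
  then have "(real (card D))\<^sup>2 * p\<^sup>2 \<le>
      q * card D * (real (card (nsets V k)) * (1 + \<omega>) ^ r) ^ r"
    using Q by (subst (asm) mult_le_cancel_left_pos) auto
  \<comment> \<open>The 2 pays for passing from all tuples to disjoint ones; the 3 bounds
    \<open>exp 1\<close>, which dominates \<open>(1 + \<omega>) ^ (r * r)\<close> by the hypothesis
    on the excess. Their product is the 6 of the claim.\<close>
  moreover have "(real (card (nsets V k)) * (1 + \<omega>) ^ r) ^ r \<le> (real (card D) * 2) * 3"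
    unfolding power_mult_distrib
  proof (rule mult_mono)
    show "real (card (nsets V k)) ^ r \<le> real (card D) * 2"
      using card_disjoint_sets_ge_half[OF V, of r k] n by (simp add: D_def)
    have "(1 + \<omega>) \<le> exp \<omega>" by (rule exp_ge_add_one_self)
    then have "((1 + \<omega>) ^ r) ^ r \<le> (exp \<omega> ^ r) ^ r"
      using overlap_excess_nonneg by (intro power_mono zero_le_power) (auto simp: \<omega>_def)
    also have "\<dots> = exp ((real r)\<^sup>2 * \<omega>)"
      by (simp add: exp_of_nat_mult[symmetric] power2_eq_square mult.assoc)
    also have "\<dots> \<le> exp 1" using exc by (simp add: \<omega>_def)
    also have "\<dots> \<le> 3" by (rule exp_le)
    finally show "((1 + \<omega>) ^ r) ^ r \<le> 3" .
  qed (use overlap_excess_nonneg in \<open>auto simp: \<omega>_def intro!: zero_le_power\<close>)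
  moreover have D0: "0 < card D"
  proof -
    have "0 < card (nsets V k)" using kV by simp
    then have "0 < real (card (nsets V k)) ^ r / 2" by simp
    also have "\<dots> \<le> real (card D)"
      using card_disjoint_sets_ge_half[OF V, of r k] n by (simp add: D_def)
    finally show ?thesis by simp
  qed
  moreover have "0 \<le> q" by (simp add: q_def)
  ultimately have "(real (card D))\<^sup>2 * p\<^sup>2 \<le> q * card D * ((real (card D) * 2) * 3)"
    by (meson mult_left_mono mult_nonneg_nonneg of_nat_0_le_iff order_trans)
  then have "p\<^sup>2 \<le> q * 6"
    using D0 by (simp add: power2_eq_square)
  then show ?thesis
    by (simp add: prob_chromatic_number_le p_def q_def V_def E)
qed

section \<open>Counting proper colourings\<close>

lemma proper_colouring_iff_inner_pairs:
  assumes "S \<subseteq> nsets V 2" "f ` V \<subseteq> {..<T}"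
  shows "proper_colouring (V, S) T f \<longleftrightarrow> S \<inter> inner_pairs T (\<lambda>c. {v \<in> V. f v = c}) = {}"
proof -
  have "proper_colouring (V, S) T f \<longleftrightarrow> (\<forall>u v. {u, v} \<in> S \<longrightarrow> f u \<noteq> f v)"
    using assms by (simp add: proper_colouring_def)
  also have "\<dots> \<longleftrightarrow> S \<inter> inner_pairs T (\<lambda>c. {v \<in> V. f v = c}) = {}"
  proof
    assume *: "\<forall>u v. {u, v} \<in> S \<longrightarrow> f u \<noteq> f v"
    show "S \<inter> inner_pairs T (\<lambda>c. {v \<in> V. f v = c}) = {}"
    proof (rule equals0I)
      fix e assume e: "e \<in> S \<inter> inner_pairs T (\<lambda>c. {v \<in> V. f v = c})"
      then have "card e = 2" using assms by (auto simp: nsets_def)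
      then obtain u v where "e = {u, v}" by (auto simp: card_2_iff)
      moreover from this have "f u \<noteq> f v" using * e by blast
      ultimately show False using e by (auto simp: inner_pairs_def nsets_def)
    qed
  next
    assume *: "S \<inter> inner_pairs T (\<lambda>c. {v \<in> V. f v = c}) = {}"
    show "\<forall>u v. {u, v} \<in> S \<longrightarrow> f u \<noteq> f v"
    proof (intro allI impI notI)
      fix u v assume uv: "{u, v} \<in> S" "f u = f v"
      then have "{u, v} \<in> nsets V 2" using assms(1) by blast
      then have "u \<in> V" "{u, v} \<in> nsets {w \<in> V. f w = f u} 2"
        using uv(2) by (auto simp: nsets_def)
      then have "{u, v} \<in> inner_pairs T (\<lambda>c. {v \<in> V. f v = c})"
        unfolding inner_pairs_def using assms(2) by blast
      with * uv show False by blast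
    qed
  qed
  finally show ?thesis .
qed

text \<open>A vertex whose colour is used twice may be recoloured with an unused colour.\<close>

lemma surjective_proper_colouring:
  assumes S: "S \<in> colourable_edges V T" and V: "finite V" and T: "T \<le> card V"
  shows "\<exists>f. proper_colouring (V, S) T f \<and> f ` V = {..<T}"
proof -
  have SV: "S \<subseteq> nsets V 2" using S by (auto simp: colourable_edges_def)
  have "m \<le> T \<Longrightarrow> \<exists>f. proper_colouring (V, S) T f \<and> m \<le> card (f ` V)" for m
  proof (induction m)
    case 0
    then show ?case using S by (auto simp: colourable_edges_def)
  next
    case (Suc m)
    then obtain f where f: "proper_colouring (V, S) T f" "m \<le> card (f ` V)" by auto
    show ?case
    proof (cases "card (f ` V) = m")
      case True
      then have "\<not> inj_on f V" using Suc.prems T V card_image by fastforce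
      then obtain u v where uv: "u \<in> V" "v \<in> V" "u \<noteq> v" "f u = f v" by (auto simp: inj_on_def)
      have "f ` V \<noteq> {..<T}" using True Suc.prems by auto
      then obtain c where c: "c < T" "c \<notin> f ` V" using f by (auto simp: proper_colouring_def)
      define f' where "f' = f(u := c)"
      have "proper_colouring (V, S) T f'"
        unfolding proper_colouring_def fst_conv snd_conv
      proof (intro conjI allI impI)
        show "f' ` V \<subseteq> {..<T}" using f c by (auto simp: f'_def proper_colouring_def)
        fix x y assume xy: "{x, y} \<in> S"
        then have "{x, y} \<in> nsets V 2" using SV by (rule subsetD[rotated])
        then have "x \<in> V" "y \<in> V" "x \<noteq> y" by (auto simp: nsets_def)
        moreover have "f x \<noteq> f y" using f xy by (auto simp: proper_colouring_def)
        ultimately show "f' x \<noteq> f' y" using c by (auto simp: f'_def)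
      qed
      moreover have "insert c (f ` V) \<subseteq> f' ` V"
      proof (intro insert_subsetI image_subsetI)
        show "c \<in> f' ` V" using uv by (auto simp: f'_def)
        fix x assume "x \<in> V"
        then show "f x \<in> f' ` V"
          using uv by (cases "x = u") (force simp: f'_def)+
      qed
      then have "card (insert c (f ` V)) \<le> card (f' ` V)" using V by (intro card_mono) auto
      then have "Suc m \<le> card (f' ` V)" using c True V by simp
      ultimately show ?thesis by blast
    qed (use f in force)
  qed
  then obtain f where f: "proper_colouring (V, S) T f" "T \<le> card (f ` V)" by blast
  then have "f ` V = {..<T}"
    by (intro card_seteq) (auto simp: proper_colouring_def)
  with f show ?thesis by blast
qed

text \<open>Permuting the colours of a surjective proper colouring gives different colourings.
  Dividing by \<open>fact T\<close> lowers the exponent per vertex by about \<open>ln 2 / 2\<close>,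
  without which the lower bound on the chromatic number would be too weak.\<close>

lemma fact_le_card_proper_colourings:
  assumes S: "S \<in> colourable_edges V T" and V: "finite V" and T: "T \<le> card V"
  shows "fact T \<le> card {f \<in> PiE V (\<lambda>_. {..<T}). proper_colouring (V, S) T f}" (is "_ \<le> card ?C")
proof -
  obtain f where f: "proper_colouring (V, S) T f" "f ` V = {..<T}"
    using surjective_proper_colouring[OF assms] by blast
  have SV: "S \<subseteq> nsets V 2" using S by (auto simp: colourable_edges_def)
  let ?g = "\<lambda>\<pi>. restrict (\<pi> \<circ> f) V"
  let ?P = "{\<pi>. \<pi> permutes {..<T}}"
  have "inj_on ?g ?P"
  proof (rule inj_onI, rule ext)
    fix \<pi> \<rho> c assume p: "\<pi> \<in> ?P" "\<rho> \<in> ?P" and eq: "?g \<pi> = ?g \<rho>"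
    show "\<pi> c = \<rho> c"
    proof (cases "c < T")
      case True
      then obtain v where "v \<in> V" "c = f v" using f(2) by (metis imageE lessThan_iff)
      then show ?thesis using fun_cong[OF eq, of v] by simp
    next
      case False
      then show ?thesis using p by (simp add: permutes_def)
    qed
  qed
  moreover have "?g ` ?P \<subseteq> ?C"
  proof (rule image_subsetI)
    fix \<pi> assume "\<pi> \<in> ?P"
    then have p: "\<pi> permutes {..<T}" by simp
    have in_T: "?g \<pi> \<in> PiE V (\<lambda>_. {..<T})"
      using p f permutes_in_image[OF p] by (auto simp: proper_colouring_def)
    have "proper_colouring (V, S) T (?g \<pi>)"
      unfolding proper_colouring_def fst_conv snd_conv
    proof (intro conjI allI impI)
      show "?g \<pi> ` V \<subseteq> {..<T}" using in_T by auto
      fix u v assume uv: "{u, v} \<in> S"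
      then have "{u, v} \<in> nsets V 2" using SV by (rule subsetD[rotated])
      then have "u \<in> V" "v \<in> V" by (auto simp: nsets_def)
      moreover have "f u \<noteq> f v" using f uv by (auto simp: proper_colouring_def)
      ultimately show "?g \<pi> u \<noteq> ?g \<pi> v"
        using permutes_inj[OF p] by (auto dest: injD)
    qed
    with in_T show "?g \<pi> \<in> ?C" by simp
  qed
  moreover have "finite ?C"
    using V by (intro finite_subset[of ?C "PiE V (\<lambda>_. {..<T})"]) (auto intro: finite_PiE)
  ultimately have "card ?P \<le> card ?C" by (rule card_inj_on_le)
  then show ?thesis by (simp add: card_permutations)
qed

text \<open>By Cauchy-Schwarz the sum of squared class sizes is smallest for equal classes, of size
  \<open>card V / T\<close>.\<close>

lemma monochromatic_pairs_ge:
  assumes V: "finite V" and T: "0 < T" and f: "f ` V \<subseteq> {..<T}"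
  shows "real (card V) * (real (card V) / real T - 1) / 2 \<le>
    real (card (inner_pairs T (\<lambda>c. {v \<in> V. f v = c})))"
proof -
  let ?a = "\<lambda>c. real (card {v \<in> V. f v = c})"
  let ?n = "real (card V)"
  have "(\<Sum>c<T. \<Sum>v\<in>{v \<in> V. f v = c}. 1) = (\<Sum>v\<in>V. 1::real)"
    by (rule sum.group) (use V f in auto)
  then have sum: "(\<Sum>c<T. ?a c) = ?n" by simp
  have "?n\<^sup>2 \<le> T * (\<Sum>c<T. (?a c)\<^sup>2)"
    using Cauchy_Schwarz_ineq_sum[of "\<lambda>_. 1" ?a "{..<T}"] by (simp add: sum)
  then have "?n\<^sup>2 / T \<le> (\<Sum>c<T. (?a c)\<^sup>2)"
    using T by (simp add: divide_le_eq mult.commute)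
  moreover have *: "?n * (?n / T - 1) = ?n\<^sup>2 / T - ?n"
    by (simp add: power2_eq_square right_diff_distrib)
  ultimately have "?n * (?n / T - 1) / 2 \<le> ((\<Sum>c<T. (?a c)\<^sup>2) - (\<Sum>c<T. ?a c)) / 2"
    unfolding sum * by (intro divide_right_mono diff_right_mono) simp_all
  also have "\<dots> = (\<Sum>c<T. ?a c * (?a c - 1) / 2)"
    by (simp add: sum_subtractf[symmetric] sum_divide_distrib power2_eq_square algebra_simps)
  also have "\<dots> = (\<Sum>c<T. real (card {v \<in> V. f v = c} choose 2))"
    by (intro sum.cong refl) (simp add: binomial_gbinomial gbinomial_prod_rev numeral_2_eq_2)
  also have "\<dots> = real (card (inner_pairs T (\<lambda>c. {v \<in> V. f v = c})))"
    by (subst card_inner_pairs_disjoint) (use V in \<open>auto simp: disjoint_family_on_def\<close>)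
  finally show ?thesis .
qed

text \<open>Double counting of edge sets with proper maps: each colourable edge set has at least
  \<open>fact T\<close> of them, and each of the \<open>T ^ n\<close> maps is proper only if all its
  monochromatic pairs are absent.\<close>

lemma prob_chromatic_number_le_first_moment:
  assumes T: "0 < T" "T \<le> n"
  shows "measure_pmf.prob (binomial_random_graph n (1/2)) {G. chromatic_number G \<le> T} \<le>
    real T ^ n / (fact T * 2 powr (real n * (real n / real T - 1) / 2))"
proof -
  define V where "V = {..<n}"
  define E where "E = nsets V 2"
  define P where "P = PiE V (\<lambda>_. {..<T})"
  define b where "b = real n * (real n / real T - 1) / 2"
  let ?mono = "\<lambda>f. inner_pairs T (\<lambda>c. {v \<in> V. f v = c})"
  have V: "finite V" "card V = n" by (auto simp: V_def)
  have E: "finite E" "card E = n choose 2"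
    using V by (auto simp: E_def finite_imp_finite_nsets)
  have P: "finite P" "card P = T ^ n" using V by (auto simp: P_def card_PiE intro: finite_PiE)
  have fV: "f ` V \<subseteq> {..<T}" if "f \<in> P" for f using that by (auto simp: P_def)
  have colE: "colourable_edges V T \<subseteq> Pow E" by (auto simp: colourable_edges_def E_def)
  have "card (colourable_edges V T) * fact T = (\<Sum>S\<in>colourable_edges V T. fact T :: real)" by simp
  also have "\<dots> \<le> (\<Sum>S\<in>colourable_edges V T. \<Sum>f\<in>P. of_bool (S \<inter> ?mono f = {}))"
  proof (rule sum_mono)
    fix S assume S: "S \<in> colourable_edges V T"
    then have SE: "S \<subseteq> nsets V 2" by (auto simp: colourable_edges_def)
    have "{f \<in> P. proper_colouring (V, S) T f} = P \<inter> {f. S \<inter> ?mono f = {}}"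
      using proper_colouring_iff_inner_pairs[OF SE] fV by blast
    then have "fact T \<le> card (P \<inter> {f. S \<inter> ?mono f = {}})"
      using fact_le_card_proper_colourings[OF S V(1)] T V by (simp add: P_def)
    then have "real (fact T) \<le> real (card (P \<inter> {f. S \<inter> ?mono f = {}}))"
      by (rule of_nat_mono)
    then show "fact T \<le> (\<Sum>f\<in>P. of_bool (S \<inter> ?mono f = {}) :: real)"
      using P by (simp add: of_bool_def sum.If_cases)
  qed
  also have "\<dots> \<le> (\<Sum>S\<in>Pow E. \<Sum>f\<in>P. of_bool (S \<inter> ?mono f = {}))"
    by (rule sum_mono2) (use E colE in \<open>auto intro: sum_nonneg\<close>)
  also have "\<dots> = (\<Sum>f\<in>P. \<Sum>S\<in>Pow E. of_bool (S \<inter> ?mono f = {}))"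
    by (rule sum.swap)
  also have "\<dots> \<le> (\<Sum>f\<in>P. 2 ^ card E / 2 powr b)"
  proof (rule sum_mono)
    fix f assume f: "f \<in> P"
    have mono: "?mono f \<subseteq> E" unfolding inner_pairs_def E_def by (intro UN_least nsets_mono) auto
    have "(\<Sum>S\<in>Pow E. of_bool (S \<inter> ?mono f = {})) = real (card {S \<in> Pow E. S \<inter> ?mono f = {}})"
      using E by (simp add: of_bool_def sum.If_cases Int_def)
    also have "\<dots> = 2 ^ card E / 2 ^ card (?mono f)"
      by (rule card_subsets_avoiding[OF E(1) mono])
    also have "\<dots> \<le> 2 ^ card E / 2 powr b"
    proof (rule divide_left_mono)
      have "2 powr b \<le> 2 powr real (card (?mono f))"
        using monochromatic_pairs_ge[OF V(1) T(1) fV[OF f]] by (auto simp: b_def V)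
      then show "2 powr b \<le> 2 ^ card (?mono f)" by (simp add: powr_realpow)
    qed auto
    finally show "(\<Sum>S\<in>Pow E. of_bool (S \<inter> ?mono f = {})) \<le> 2 ^ card E / 2 powr b" .
  qed
  also have "\<dots> = real T ^ n * (2 ^ card E / 2 powr b)" by (simp add: P)
  finally have "card (colourable_edges V T) / 2 ^ card E \<le> real T ^ n / (fact T * 2 powr b)"
    by (simp add: field_simps)
  then show ?thesis
    by (simp add: prob_chromatic_number_le V_def[symmetric] E b_def)
qed

section \<open>Asymptotic estimates\<close>

lemma falling_mult_fact: "l \<le> k \<Longrightarrow> falling k l * fact (k - l) = fact k"
proof (induction l)
  case (Suc l)
  have "fact (k - l) = (k - l) * fact (k - Suc l)"
    using Suc.prems by (metis Suc_diff_Suc Suc_le_eq fact_Suc of_nat_id)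
  then show ?case using Suc by (simp add: falling_def mult_ac)
qed (simp add: falling_def)

lemma falling_le_fact: "l \<le> k \<Longrightarrow> falling k l \<le> fact k"
  using falling_mult_fact[of l k] fact_ge_1[of "k - l"]
  by (metis mult.right_neutral mult_le_mono2)

lemma falling_le_power: "falling k l \<le> k ^ l"
proof -
  have "falling k l \<le> (\<Prod>j<l. k)" unfolding falling_def by (rule prod_mono) auto
  then show ?thesis by simp
qed

lemma two_power_choose_2: "(2::real) ^ (l choose 2) = 2 powr (real l * (real l - 1) / 2)"
proof -
  have "real (l choose 2) = real l * (real l - 1) / 2"
    by (simp add: binomial_gbinomial gbinomial_prod_rev numeral_2_eq_2)
  then show ?thesis by (simp only: powr_realpow[symmetric] zero_less_numeral)
qed

text \<open>For \<open>l\<close> up to \<open>k / 2\<close> the term is at most an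
  \<open>l\<close>-th power whose base is at most \<open>z\<close>, since
  \<open>2 powr ((l - 1) / 2)\<close> is at most \<open>2 powr (k / 4)\<close> and \<open>x\<close>
  is at least \<open>2 powr (k / 2)\<close>.\<close>

lemma overlap_term_le_small:
  fixes x :: real and k l :: nat
  defines "z \<equiv> (real k)\<^sup>2 * 2 powr (- real k / 4)"
  assumes x: "2 powr (real k / 2) \<le> x" and z: "z \<le> 1" and l: "2 \<le> l" "2 * l \<le> k"
  shows "real (k choose l) * 2 ^ (l choose 2) * (falling k l / x ^ l) \<le> z\<^sup>2"
proof -
  have x0: "0 < x" by (rule less_le_trans[OF _ x]) simp
  let ?B = "(real k)\<^sup>2 * 2 powr ((real l - 1) / 2) / x"
  have "real (k choose l) * 2 ^ (l choose 2) * (falling k l / x ^ l) \<le>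
      real k ^ l * 2 ^ (l choose 2) * (real k ^ l / x ^ l)"
  proof (intro mult_mono divide_right_mono)
    show "real (k choose l) \<le> real k ^ l"
      using of_nat_mono[OF binomial_le_pow[of l k], where 'a = real] l by simp
    show "real (falling k l) \<le> real k ^ l"
      using of_nat_mono[OF falling_le_power[of k l], where 'a = real] by simp
  qed (use x0 in auto)
  also have "\<dots> = ?B ^ l"
  proof -
    have "(2::real) ^ (l choose 2) = (2 powr ((real l - 1) / 2)) ^ l"
      by (simp add: two_power_choose_2 powr_power mult_ac)
    then show ?thesis by (simp add: power_mult_distrib power_divide power2_eq_square)
  qed
  also have "?B \<le> z"
  proof -
    have "?B \<le> (real k)\<^sup>2 * 2 powr (real k / 4) / 2 powr (real k / 2)"
      by (intro frac_le mult_left_mono x) (use l in auto)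
    also have "\<dots> = z" proof -
      have "(2::real) powr (real k / 4) / 2 powr (real k / 2) = 2 powr (real k / 4 - real k / 2)"
        by (rule powr_diff[symmetric])
      also have "real k / 4 - real k / 2 = - real k / 4" by simp
      finally show ?thesis by (simp only: z_def times_divide_eq_right[symmetric])
    qed
    finally show ?thesis .
  qed
  then have "?B ^ l \<le> z ^ l" using x0 by (intro power_mono) auto
  also have "z ^ l \<le> z\<^sup>2" by (rule power_decreasing) (use l z in \<open>auto simp: z_def\<close>)
  finally show ?thesis .
qed

text \<open>The bound is the term for \<open>l = k\<close>, essentially the inverse of the expected
  number of independent \<open>k\<close>-sets. Lowering \<open>l\<close> by \<open>u\<close> costs
  at most a factor \<open>?B ^ u\<close> with \<open>?B \<le> 1\<close>.\<close>

lemma overlap_term_le_large: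
  fixes x :: real and k l :: nat
  assumes x: "0 < x" "x \<le> real k * 2 powr (real k / 2)"
    and z: "2 * ((real k)\<^sup>2 * 2 powr (- real k / 4)) \<le> 1" and l: "l \<le> k" "k \<le> 2 * l"
  shows "real (k choose l) * 2 ^ (l choose 2) * (falling k l / x ^ l) \<le>
    fact k * 2 ^ (k choose 2) / x ^ k"
proof -
  define u where "u = k - l"
  have k: "k = l + u" "real k = real l + real u" using l by (auto simp: u_def)
  let ?B = "real k * 2 powr (- (2 * real k - 1 - real u) / 2) * x"
  have "real (k choose l) * 2 ^ (l choose 2) * (falling k l / x ^ l) \<le>
      real k ^ u * 2 ^ (l choose 2) * (fact k / x ^ l)"
  proof (intro mult_mono divide_right_mono)
    have "k choose l = (k choose u)" unfolding u_def by (rule binomial_symmetric[OF l(1)])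
    also have "\<dots> \<le> k ^ u" by (rule binomial_le_pow) (simp add: u_def)
    finally have "real (k choose l) \<le> real (k ^ u)" by (rule of_nat_mono)
    then show "real (k choose l) \<le> real k ^ u" by simp
    show "real (falling k l) \<le> fact k"
      using of_nat_mono[OF falling_le_fact[OF l(1)], where 'a = real] by simp
  qed (use x in auto)
  also have "\<dots> = fact k * 2 ^ (k choose 2) / x ^ k * ?B ^ u"
  proof -
    have "(2::real) ^ (l choose 2) = 2 ^ (k choose 2) * (2 powr (- (2 * real k - 1 - real u) / 2)) ^ u"
    proof -
      have "real l * (real l - 1) / 2 =
          real k * (real k - 1) / 2 + - (2 * real k - 1 - real u) / 2 * real u"
        by (simp add: k(2) field_simps)
      then show ?thesis
        by (simp only: two_power_choose_2 powr_power powr_add simp_thms) (simp add: mult.commute)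
    qed
    moreover have "x ^ k = x ^ l * x ^ u" by (simp add: k(1) power_add)
    ultimately show ?thesis using x by (simp add: power_mult_distrib)
  qed
  also have "?B ^ u \<le> 1"
  proof (rule power_le_one)
    \<comment> \<open>As \<open>u \<le> k / 2\<close>, the base is at most \<open>sqrt 2\<close>
      times the quantity that \<open>z\<close> bounds by 1/2.\<close>
    have "?B \<le> real k * 2 powr (1 / 2 - 3 / 4 * real k) * (real k * 2 powr (real k / 2))"
    proof (intro mult_mono)
      have "2 * real u \<le> real k" using l k by linarith
      then show "2 powr (- (2 * real k - 1 - real u) / 2) \<le> (2::real) powr (1 / 2 - 3 / 4 * real k)"
        by (simp add: field_simps)
    qed (use x in auto)
    also have "\<dots> = (real k)\<^sup>2 * 2 powr (- real k / 4) * 2 powr (1/2)"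
    proof -
      have "(2::real) powr (1 / 2 - 3 / 4 * real k) * 2 powr (real k / 2) =
          2 powr (- real k / 4) * 2 powr (1/2)"
        by (subst (1 2) powr_add[symmetric]) (simp add: field_simps)
      then show ?thesis by (simp add: power2_eq_square)
    qed
    also have "\<dots> \<le> (real k)\<^sup>2 * 2 powr (- real k / 4) * 2 powr 1"
      by (intro mult_left_mono powr_mono) auto
    also have "\<dots> \<le> 1" using z by simp
    finally show "?B \<le> 1" .
  qed (use x in auto)
  then have "fact k * 2 ^ (k choose 2) / x ^ k * ?B ^ u \<le> fact k * 2 ^ (k choose 2) / x ^ k * 1"
    using x by (intro mult_left_mono) auto
  finally show ?thesis by simp
qed

text \<open>Induction with \<open>exp 1 \<le> (1 + 1 / k) ^ (k + 1)\<close>. The polynomial factor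
  is not sharp, but polynomial factors are absorbed later.\<close>

lemma fact_le_Stirling:
  "k \<ge> 1 \<Longrightarrow> fact k \<le> exp 1 * real k * (real k / exp 1) ^ k"
proof (induction k rule: nat_induct_at_least)
  case (Suc k)
  have "1 / (real k + 1) \<le> ln ((real k + 1) / real k)"
    using ln_le_minus_one[of "real k / (real k + 1)"] Suc.hyps
    by (simp add: ln_div field_simps)
  then have "1 \<le> real (Suc k) * ln ((real k + 1) / real k)"
    using Suc.hyps by (simp add: field_simps)
  then have "exp 1 \<le> exp (real (Suc k) * ln ((real k + 1) / real k))" by simp
  also have "\<dots> = ((real k + 1) / real k) ^ Suc k"
    using Suc.hyps by (simp only: exp_of_nat_mult) simp
  finally have "real k ^ Suc k * exp 1 \<le> (real k + 1) ^ Suc k"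
    using Suc.hyps by (simp add: power_divide pos_le_divide_eq mult.commute)
  then have *: "real k * (real k / exp 1) ^ k \<le> ((real k + 1) / exp 1) ^ Suc k"
    by (simp add: power_divide field_simps)
  have "fact (Suc k) \<le> (real k + 1) * (exp 1 * real k * (real k / exp 1) ^ k)"
    using mult_left_mono[OF Suc.IH, of "real k + 1"] by (simp add: algebra_simps)
  also have "\<dots> \<le> (real k + 1) * (exp 1 * ((real k + 1) / exp 1) ^ Suc k)"
    using mult_left_mono[OF *, of "(real k + 1) * exp 1"] by (simp add: mult_ac)
  finally show ?case by (simp add: mult_ac add.commute)
qed simp

text \<open>Induction with \<open>(1 + 1 / k) ^ k \<le> exp 1\<close>.\<close>

lemma fact_ge_Stirling: "(real k / exp 1) ^ k \<le> fact k"
proof (induction k)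
  case (Suc k)
  show ?case
  proof (cases "k = 0")
    case False
    have "((real k + 1) / real k) ^ k \<le> exp 1"
      using exp_ge_one_plus_x_over_n_power_n[of k 1] False by (simp add: add_divide_distrib add.commute)
    then have "(real k + 1) ^ k \<le> real k ^ k * exp 1"
      using False by (simp add: power_divide pos_divide_le_eq mult.commute)
    then have "((real k + 1) / exp 1) ^ k \<le> exp 1 * (real k / exp 1) ^ k"
      unfolding power_divide by (subst times_divide_eq_right, intro divide_right_mono) (simp_all add: mult.commute)
    then have "(real k + 1) / exp 1 * ((real k + 1) / exp 1) ^ k \<le>
        (real k + 1) / exp 1 * (exp 1 * (real k / exp 1) ^ k)"
      by (intro mult_left_mono) auto
    then have "((real k + 1) / exp 1) ^ Suc k \<le> (real k + 1) * (real k / exp 1) ^ k"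
      by simp
    also have "\<dots> \<le> (real k + 1) * fact k" by (intro mult_left_mono Suc.IH) auto
    finally show ?thesis by (simp add: add.commute)
  qed simp
qed simp

section \<open>The overlap excess from the start of a window on\<close>

text \<open>The point \<open>y\<^sub>k\<close>: up to polynomial factors in \<open>k\<close> the
  expected number of independent \<open>k\<close>-sets is \<open>2 powr (k / 4)\<close> there, the
  square root of the number of vertices. The shift 1/4 in the exponent produces this.\<close>

definition window_start :: "nat \<Rightarrow> real" where
  "window_start k = real k * 2 powr (real k / 2 - 1 / 4) / exp 1"

lemma eventually_poly_le_powr:
  assumes "0 < (\<delta>::real)"
  shows "\<forall>\<^sub>F k::nat in sequentially. 100 * real k ^ 6 \<le> 2 powr (\<delta> * real k)"
  using assms by real_asymp

lemma eventually_power_le_window_start: "\<forall>\<^sub>F k in sequentially. 2 powr (real k / 2) \<le> window_start k - real k"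
  unfolding window_start_def by real_asymp

lemma eventually_square_le_power: "\<forall>\<^sub>F k::nat in sequentially. 2 * ((real k)\<^sup>2 * 2 powr (- real k / 4)) \<le> 1"
  by real_asymp

lemma eventually_square_le_window_start: "\<forall>\<^sub>F k in sequentially. 2 * (real k)\<^sup>2 \<le> window_start k"
  unfolding window_start_def by real_asymp

lemma overlap_excess_le:
  fixes x :: real and k m :: nat
  assumes x: "2 powr (real k / 2) \<le> x" "x \<le> real k * 2 powr (real k / 2)" "x \<le> real m"
    and z: "2 * ((real k)\<^sup>2 * 2 powr (- real k / 4)) \<le> 1"
  shows "overlap_excess k m \<le>
    real k * (((real k)\<^sup>2 * 2 powr (- real k / 4))\<^sup>2 + fact k * 2 ^ (k choose 2) / x ^ k)"
    (is "_ \<le> real k * ?b")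
proof -
  have x0: "0 < x" by (rule less_le_trans[OF _ x(1)]) simp
  have "overlap_excess k m \<le> (\<Sum>l = 2..k. ?b)"
    unfolding overlap_excess_def
  proof (rule sum_mono)
    fix l assume l: "l \<in> {2..k}"
    have "real (k choose l) * 2 ^ (l choose 2) * (falling k l / real m ^ l) \<le>
        real (k choose l) * 2 ^ (l choose 2) * (falling k l / x ^ l)"
      using x x0 by (intro mult_left_mono divide_left_mono power_mono) auto
    also have "\<dots> \<le> ?b"
    proof (cases "2 * l \<le> k")
      case True
      have "(real k)\<^sup>2 * 2 powr (- real k / 4) \<le> 1"
        using z by (rule order_trans[rotated]) simp
      then have "real (k choose l) * 2 ^ (l choose 2) * (falling k l / x ^ l) \<le>
          ((real k)\<^sup>2 * 2 powr (- real k / 4))\<^sup>2"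
        using overlap_term_le_small[OF x(1), of l] l True by auto
      also have "\<dots> \<le> ?b" using x0 by simp
      finally show ?thesis .
    next
      case False
      then have "real (k choose l) * 2 ^ (l choose 2) * (falling k l / x ^ l) \<le>
          fact k * 2 ^ (k choose 2) / x ^ k"
        using overlap_term_le_large[OF x0 x(2) z, of l] l by auto
      also have "\<dots> \<le> ?b" by simp
      finally show ?thesis .
    qed
    finally show "real (k choose l) * 2 ^ (l choose 2) * (falling k l / real m ^ l) \<le> ?b" .
  qed
  also have "\<dots> = real (k - 1) * ?b" by simp
  also have "\<dots> \<le> real k * ?b"
    using x0 by (intro mult_right_mono add_nonneg_nonneg) auto
  finally show ?thesis .
qed

text \<open>Stirling cancels \<open>(k / exp 1) ^ k\<close>, and the gap between the shifts 1/2 and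
  1/4 in the two exponents leaves \<open>2 powr (- k / 4)\<close>. Passing from
  \<open>window_start k - k\<close> to \<open>window_start k\<close> costs a factor 2, by
  Bernoulli's inequality; the 3 bounds \<open>exp 1\<close>.\<close>

lemma inverse_expected_copies_le:
  fixes k :: nat
  assumes k: "1 \<le> k" and y: "2 * (real k)\<^sup>2 \<le> window_start k"
  shows "fact k * 2 ^ (k choose 2) / (window_start k - k) ^ k \<le> 6 * real k * 2 powr (- real k / 4)"
proof -
  let ?y = "window_start k"
  have y0: "0 < ?y" using k by (simp add: window_start_def)
  have "real k * 1 \<le> real k * real k" using k by (intro mult_left_mono) auto
  then have "real k \<le> ?y" using y zero_le_power2[of "real k"] by (simp add: power2_eq_square)
  then have ky: "real k / ?y \<le> 1" using y0 by simp
  have "(real k)\<^sup>2 / ?y \<le> 1 / 2" using y y0 by (simp add: field_simps)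
  then have "1 / 2 \<le> 1 + real k * (- (real k / ?y))" by (simp add: power2_eq_square)
  also have "\<dots> \<le> (1 + - (real k / ?y)) ^ k"
    by (rule Bernoulli_inequality) (use ky in auto)
  finally have "?y ^ k * (1 / 2) \<le> ?y ^ k * (1 - real k / ?y) ^ k"
    using y0 by (intro mult_left_mono) auto
  also have "\<dots> = (?y - real k) ^ k"
    using y0 by (simp add: power_mult_distrib[symmetric] right_diff_distrib)
  finally have lower: "?y ^ k / 2 \<le> (?y - real k) ^ k" by simp
  have "fact k * 2 ^ (k choose 2) / (?y - real k) ^ k \<le> fact k * 2 ^ (k choose 2) / (?y ^ k / 2)"
    using lower y0 by (intro divide_left_mono) (auto intro!: mult_pos_pos less_le_trans[OF _ lower])
  also have "\<dots> \<le> exp 1 * real k * (real k / exp 1) ^ k * 2 ^ (k choose 2) / (?y ^ k / 2)"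
    using fact_le_Stirling[OF k] y0 by (intro divide_right_mono mult_right_mono) auto
  also have "\<dots> = exp 1 * real k * (real k / exp 1) ^ k * (2 powr (real k / 2 - 1 / 2)) ^ k /
      ((real k / exp 1) ^ k * (2 powr (real k / 2 - 1 / 4)) ^ k / 2)"
    by (simp add: window_start_def two_power_choose_2 powr_power power_mult_distrib power_divide field_simps)
  also have "\<dots> = 2 * exp 1 * real k * ((2 powr (real k / 2 - 1 / 2)) ^ k / (2 powr (real k / 2 - 1 / 4)) ^ k)"
    using k by simp
  also have "(2 powr (real k / 2 - 1 / 2)) ^ k / (2 powr (real k / 2 - 1 / 4)) ^ k = (2::real) powr (- real k / 4)"
  proof -
    have "(2::real) powr (real k / 2 - 1 / 2) / 2 powr (real k / 2 - 1 / 4) =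
        2 powr ((real k / 2 - 1 / 2) - (real k / 2 - 1 / 4))"
      by (rule powr_diff[symmetric])
    also have "\<dots> = 2 powr (- 1 / 4)" by simp
    finally have "(2 powr (real k / 2 - 1 / 2) / 2 powr (real k / 2 - 1 / 4)) ^ k = (2 powr (- 1 / 4) :: real) ^ k"
      by simp
    then show ?thesis by (simp only: power_divide) (simp add: powr_power)
  qed
  also have "2 * exp 1 * real k * 2 powr (- real k / 4) \<le> 2 * 3 * real k * 2 powr (- real k / 4)"
    by (intro mult_right_mono mult_left_mono exp_le) auto
  finally show ?thesis by simp
qed

text \<open>The threshold 1/4 enters here: the excess is a polynomial in \<open>k\<close> times
  \<open>2 powr (- k / 4)\<close>, while \<open>2 powr (c * k)\<close> will bound the square of the
  number of planted sets.\<close>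

lemma eventually_overlap_excess_le:
  assumes c: "c < 1 / 4"
  shows "\<forall>\<^sub>F k in sequentially. \<forall>m::nat. window_start k \<le> real m \<longrightarrow>
    2 powr (c * real k) * overlap_excess k (m - k) \<le> 1"
proof -
  have "\<forall>\<^sub>F k::nat in sequentially. 100 * real k ^ 6 \<le> 2 powr ((1 / 4 - c) * real k)"
    using c by (intro eventually_poly_le_powr) simp
  with eventually_power_le_window_start eventually_square_le_power eventually_square_le_window_start
    eventually_ge_at_top[of 1] show ?thesis
  proof eventually_elim
    case (elim k)
    show ?case
    proof (intro allI impI)
      fix m :: nat assume m: "window_start k \<le> real m"
      let ?p = "2 powr (c * real k)" and ?q = "2 powr (- real k / 4) :: real"
      have "?q \<le> 2 powr 0" by (intro powr_mono) auto
      then have q: "0 < ?q" "?q \<le> 1" by auto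
      have "window_start k - k \<le> real (m - k)" using m by linarith
      moreover have "window_start k - k \<le> real k * 2 powr (real k / 2)"
      proof -
        have "window_start k \<le> real k * 2 powr (real k / 2 - 1 / 4) / 1"
          unfolding window_start_def by (intro divide_left_mono) auto
        also have "\<dots> \<le> real k * 2 powr (real k / 2)" by (simp add: mult_left_mono)
        finally show ?thesis by simp
      qed
      ultimately have "overlap_excess k (m - k) \<le>
          real k * (((real k)\<^sup>2 * ?q)\<^sup>2 + fact k * 2 ^ (k choose 2) / (window_start k - k) ^ k)"
        using elim by (intro overlap_excess_le) auto
      also have "\<dots> \<le> real k * (((real k)\<^sup>2 * ?q)\<^sup>2 + 6 * real k * ?q)"
        using elim by (intro mult_left_mono add_left_mono inverse_expected_copies_le) auto
      also have "\<dots> = (real k ^ 5 * ?q + 6 * real k ^ 2) * ?q"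
        by (simp add: power2_eq_square algebra_simps numeral_eq_Suc)
      also have "\<dots> \<le> (real k ^ 6 * 1 + 6 * real k ^ 6) * ?q"
        using elim q by (intro mult_right_mono add_mono mult_mono mult_left_mono power_increasing) auto
      also have "\<dots> \<le> 100 * real k ^ 6 * ?q"
        using q by simp
      also have "\<dots> \<le> 2 powr ((1 / 4 - c) * real k) * ?q"
        using elim q by (intro mult_right_mono) auto
      also have "\<dots> = 2 powr ((1 / 4 - c) * real k + - real k / 4)"
        by (rule powr_add[symmetric])
      also have "\<dots> = 2 powr (- (c * real k))" by (simp add: algebra_simps)
      finally have "?p * overlap_excess k (m - k) \<le> ?p * 2 powr (- (c * real k))"
        by (intro mult_left_mono) auto
      also have "\<dots> = 1" by (simp add: powr_minus)
      finally show "?p * overlap_excess k (m - k) \<le> 1" .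
    qed
  qed
qed

section \<open>The lower bound on the chromatic number from counting colourings\<close>

text \<open>The point where upper and lower bounds are compared. It exceeds
  \<open>window_start k\<close> by the factor \<open>2 powr (1 / 4)\<close>, so it lies inside the
  \<open>k\<close>-th window.\<close>

definition window_end :: "nat \<Rightarrow> real" where
  "window_end k = real k * 2 powr (real k / 2) / exp 1"

text \<open>Slightly below \<open>2 / ln 2 = 2.885\<dots>\<close>, so that the bound \<open>ln 2 \<le> 25/36\<close> suffices.\<close>

definition \<beta> :: real where "\<beta> = 2879 / 1000"

text \<open>The exponent in the first moment bound, per vertex, tends to \<open>\<beta> ln 2 / 2 - 1\<close>.\<close>

lemma eventually_exponent_le:
  "\<forall>\<^sub>F k::nat in sequentially.
     (1 - 1 / (real k - \<beta>) + 1 / (real k)\<^sup>2) *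
       (real k / 2 * ln 2 + ln (real k) - 1 + ln (1 + 1 / real k) - ln (real k - \<beta>)) +
     1 / (real k - \<beta>) - ln 2 / 2 * (real k - \<beta> - 1) \<le> - 1 / 10000"
proof -
  let ?g = "\<lambda>k::real. (1 - 1 / (k - 2879/1000) + 1 / k\<^sup>2) *
      (k / 2 * ln 2 + ln k - 1 + ln (1 + 1 / k) - ln (k - 2879/1000))
    + 1 / (k - 2879/1000) - ln 2 / 2 * (k - 2879/1000 - 1)"
  have "((\<lambda>k::nat. ?g (real k)) \<longlongrightarrow> ln 2 / 2 * (2879/1000) - 1) at_top"
    by real_asymp
  moreover have "ln 2 / 2 * (2879/1000) - 1 < (- 1 / 10000 :: real)"
    using ln2_le_25_over_36 by simp
  ultimately have "\<forall>\<^sub>F k::nat in sequentially. ?g (real k) < - 1 / 10000"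
    by (rule order_tendstoD(2))
  then show ?thesis
    by eventually_elim (simp add: \<beta>_def)
qed

text \<open>The logarithm of the first moment bound is at most a negative multiple of
  \<open>n\<close>. A range of \<open>n\<close> is covered because advancing in steps overshoots
  \<open>window_end k\<close> slightly.\<close>

lemma eventually_prob_small:
  "\<forall>\<^sub>F k in sequentially. \<forall>n::nat.
     window_end k \<le> real n \<longrightarrow> real n \<le> window_end k * (1 + 1 / real k) \<longrightarrow>
     measure_pmf.prob (binomial_random_graph n (1/2))
       {G. chromatic_number G \<le> nat \<lfloor>real n / (real k - \<beta>)\<rfloor>} \<le> 1 / 4"
proof -
  \<comment> \<open>\<open>30000\<close> makes \<open>exp (- n / 10000)\<close> at most 1/4, and
    \<open>k\<^sup>2 \<le> n\<close> lets \<open>1 / n\<close> be replaced by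
    \<open>1 / k\<^sup>2\<close>.\<close>
  have "\<forall>\<^sub>F k in sequentially. max ((real k)\<^sup>2) 30000 \<le> window_end k"
    unfolding window_end_def by real_asymp
  with eventually_exponent_le eventually_ge_at_top[of "5::nat"] show ?thesis
  proof eventually_elim
    case (elim k)
    show ?case
    proof (intro allI impI)
      fix n :: nat
      assume n: "window_end k \<le> real n" "real n \<le> window_end k * (1 + 1 / real k)"
      define b where "b = real k - \<beta>"
      define x where "x = real n / b"
      define T where "T = nat \<lfloor>x\<rfloor>"
      define L where "L = real k / 2 * ln 2 + ln (real k) - 1 + ln (1 + 1 / real k) - ln b"
      have b: "1 \<le> b" "b \<le> real k" using elim by (auto simp: b_def \<beta>_def)
      have n2: "(real k)\<^sup>2 \<le> real n" "30000 \<le> real n" using elim(3) n by linarith+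
      have "real k * 1 \<le> real k * real k" using elim by (intro mult_left_mono) auto
      then have "b \<le> real n" using n2 b unfolding power2_eq_square by linarith
      then have x: "1 \<le> x" "x \<le> real n"
        using b by (auto simp: x_def divide_le_eq le_divide_eq mult_left_le)
      have T: "real T \<le> x" "x - 1 \<le> real T" "1 \<le> T" "T \<le> n"
        using x unfolding T_def by linarith+
      have lnx: "0 \<le> ln x" "ln x \<le> L"
      proof -
        show "0 \<le> ln x" using x by simp
        have "ln (real n) \<le> ln (window_end k * (1 + 1 / real k))"
          using n n2 by (subst ln_le_cancel_iff) auto
        also have "\<dots> = real k / 2 * ln 2 + ln (real k) - 1 + ln (1 + 1 / real k)"
        proof -
          have "0 < 1 + 1 / real k" by (intro add_pos_nonneg) auto
          then show ?thesis
            using elim(2) by (simp add: window_end_def ln_mult ln_div ln_powr)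
        qed
        finally show "ln x \<le> L" using b n2 by (simp add: x_def L_def ln_div)
      qed
      have "real T ^ n / (fact T * 2 powr (real n * (real n / real T - 1) / 2)) \<le>
          real T ^ n / ((real T / exp 1) ^ T * 2 powr (real n * (b - 1) / 2))"
      proof (intro divide_left_mono mult_mono)
        show "(real T / exp 1) ^ T \<le> fact T" by (rule fact_ge_Stirling)
        have "b * T \<le> b * x" using b T by (intro mult_left_mono) auto
        then have "b \<le> real n / real T" using b T by (simp add: x_def pos_le_divide_eq)
        then show "2 powr (real n * (b - 1) / 2) \<le> 2 powr (real n * (real n / real T - 1) / 2)"
          by (intro powr_mono divide_right_mono mult_left_mono) auto
      qed (use T in auto)
      also have "\<dots> = exp (real n * ln T - (real T * (ln T - 1) + ln 2 * (real n * (b - 1) / 2)))"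
      proof -
        have "real T ^ n = exp (real n * ln T)" using T by (simp add: exp_of_nat_mult)
        moreover have "(real T / exp 1) ^ T = exp (real T * (ln T - 1))"
          using T by (simp add: exp_of_nat_mult exp_diff)
        moreover have "2 powr (real n * (b - 1) / 2) = exp (ln 2 * (real n * (b - 1) / 2))"
          by (simp add: powr_def mult.commute)
        ultimately show ?thesis by (simp only: exp_add exp_diff)
      qed
      also have "\<dots> \<le> exp (- real n / 10000)"
      proof (subst exp_le_cancel_iff)
        \<comment> \<open>Rounding is harmless: \<open>T\<close> lies between \<open>x - 1\<close>
          and \<open>x\<close>.\<close>
        have "(real n - T) * ln T \<le> (real n - x + 1) * ln x"
          using T x by (intro mult_mono) auto
        then have "real n * ln T - (real T * (ln T - 1) + ln 2 * (real n * (b - 1) / 2)) \<le>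
            (real n - x + 1) * ln x + x - ln 2 * (real n * (b - 1) / 2)"
          using T by (simp add: algebra_simps)
        also have "\<dots> = real n * ((1 - 1 / b + 1 / real n) * ln x + 1 / b - ln 2 / 2 * (b - 1))"
          using n2 b by (simp add: x_def field_simps)
        also have "\<dots> \<le> real n * ((1 - 1 / b + 1 / (real k)\<^sup>2) * L + 1 / b - ln 2 / 2 * (b - 1))"
          using lnx b n2 elim
          by (intro mult_left_mono diff_right_mono add_right_mono mult_mono add_left_mono divide_left_mono) auto
        also have "\<dots> \<le> real n * (- 1 / 10000)"
          using elim by (intro mult_left_mono) (auto simp: L_def b_def)
        finally show "real n * ln T - (real T * (ln T - 1) + ln 2 * (real n * (b - 1) / 2)) \<le>
            - real n / 10000" by simp
      qed
      also have "\<dots> \<le> 1 / 4"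
      proof -
        have "4 \<le> exp (real n / 10000)"
          using exp_ge_add_one_self[of "real n / 10000"] n2 by linarith
        then show ?thesis by (simp add: exp_minus divide_simps)
      qed
      finally have "real T ^ n / (fact T * 2 powr (real n * (real n / real T - 1) / 2)) \<le> 1 / 4" .
      then have "measure_pmf.prob (binomial_random_graph n (1/2)) {G. chromatic_number G \<le> T} \<le> 1 / 4"
        using prob_chromatic_number_le_first_moment[of T n] T by linarith
      then show "measure_pmf.prob (binomial_random_graph n (1/2))
          {G. chromatic_number G \<le> nat \<lfloor>real n / (real k - \<beta>)\<rfloor>} \<le> 1 / 4"
        by (simp only: T_def x_def b_def)
    qed
  qed
qed

section \<open>Growth of the intervals\<close>

lemma prob_intersect:
  assumes "1 < measure_pmf.prob p A + measure_pmf.prob p B"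
  shows "\<exists>x. x \<in> A \<and> x \<in> B"
proof (rule ccontr)
  assume "\<not> (\<exists>x. x \<in> A \<and> x \<in> B)"
  then have "measure_pmf.prob p (A \<union> B) = measure_pmf.prob p A + measure_pmf.prob p B"
    by (intro measure_pmf.finite_measure_Union) auto
  with assms measure_pmf.prob_le_1[of p "A \<union> B"] show False by simp
qed

text \<open>The walk stops at the first point \<open>m + q * d\<close> that is at least
  \<open>t\<close>. All earlier points lie below \<open>t\<close>, where the step hypothesis
  applies, and the overshoot is at most \<open>d\<close>.\<close>

lemma advance_by_steps:
  fixes s :: "nat \<Rightarrow> real" and t b :: real
  assumes step: "\<And>n. m \<le> n \<Longrightarrow> real n \<le> t \<Longrightarrow> s (n + d) \<le> s n + b"
    and d: "0 < d" and mt: "real m \<le> t"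
  shows "\<exists>n\<ge>m. t \<le> real n \<and> real n \<le> t + real d \<and> s n \<le> s m + (real n - real m) / real d * b"
proof -
  have ex: "\<exists>q. t \<le> real (m + q * d)"
  proof -
    obtain q where "t < real q * real d" using ex_less_of_nat_mult[of "real d" t] d by auto
    then have "t \<le> real (m + q * d)" by simp
    then show ?thesis ..
  qed
  define q where "q = (LEAST q. t \<le> real (m + q * d))"
  have q: "t \<le> real (m + q * d)" unfolding q_def using ex by (rule LeastI_ex)
  have less: "real (m + j * d) < t" if "j < q" for j
    using not_less_Least[of j "\<lambda>q. t \<le> real (m + q * d)"] that by (simp add: q_def)
  have "j \<le> q \<Longrightarrow> s (m + j * d) \<le> s m + real j * b" for j
  proof (induction j)
    case (Suc j)
    then have "s (m + j * d + d) \<le> s (m + j * d) + b"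
      using less[of j] by (intro step) auto
    then show ?case using Suc by (simp add: algebra_simps)
  qed simp
  from this[of q] have "s (m + q * d) \<le> s m + (real (m + q * d) - real m) / real d * b"
    using d by simp
  moreover have "real (m + q * d) \<le> t + real d"
  proof (cases q)
    case 0
    then show ?thesis using mt by simp
  next
    case (Suc j)
    then show ?thesis using less[of j] by (simp add: algebra_simps)
  qed
  ultimately show ?thesis using q by (intro exI[of _ "m + q * d"]) auto
qed

text \<open>A step of \<open>r * k\<close> vertices raises \<open>s\<close> by about
  \<open>r\<close>, hence slope \<open>1 / k\<close>; the relative errors
  \<open>1 / k\<^sup>2\<close> add up to at most \<open>n / k ^ 3\<close>.\<close>

lemma advance_in_window:
  fixes s :: "nat \<Rightarrow> real" and t :: real
  assumes k: "1 \<le> k" and r: "1 \<le> r" and mt: "real m \<le> t"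
    and step: "\<And>n. m \<le> n \<Longrightarrow> real n \<le> t \<Longrightarrow> s (n + r * k) \<le> s n + real r * (1 + 1 / (real k)\<^sup>2)"
  shows "\<exists>n\<ge>m. t \<le> real n \<and> real n \<le> t + real (r * k) \<and>
    s n \<le> s m + (real n - real m) / real k + real n / real k ^ 3"
proof -
  let ?b = "real r * (1 + 1 / (real k)\<^sup>2)"
  obtain n where n: "m \<le> n" "t \<le> real n" "real n \<le> t + real (r * k)"
    "s n \<le> s m + (real n - real m) / real (r * k) * ?b"
    using advance_by_steps[of m t s "r * k" ?b] k r mt step by auto
  have "(real n - real m) / real (r * k) * ?b = (real n - real m) / real k * (1 + 1 / (real k)\<^sup>2)"
    using r k by (simp add: field_simps)
  also have "\<dots> = (real n - real m) / real k + (real n - real m) / real k ^ 3"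
    by (simp add: distrib_left power2_eq_square power3_eq_cube)
  also have "\<dots> \<le> (real n - real m) / real k + real n / real k ^ 3"
    by (intro add_left_mono divide_right_mono) auto
  finally have "s n \<le> s m + (real n - real m) / real k + real n / real k ^ 3"
    using n(4) by linarith
  with n(1-3) show ?thesis by blast
qed

text \<open>
  The intervals start at \<open>n/k + \<gamma> n/k\<^sup>2\<close> or below when \<open>n\<close> enters the \<open>k\<close>-th window.  One more window
  turns \<open>\<gamma>\<close> into \<open>1 + \<gamma> / \<surd>2\<close>, so any constant above the fixed point \<open>\<surd>2 / (\<surd>2 - 1) = 3.4142\<dots>\<close>
  will do.
\<close>

definition \<gamma> :: real where "\<gamma> = 3415 / 1000"

text \<open>The tolerated overshoot \<open>1 + 1 / k\<close> is exactly the growth of the linear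
  factor of \<open>window_start\<close>, so only the ratio \<open>sqrt 2\<close> remains.\<close>

lemma window_start_Suc:
  assumes "1 \<le> k"
  shows "window_start k * (1 + 1 / real k) = window_start (Suc k) / sqrt 2"
proof -
  have "(2::real) powr (real (Suc k) / 2 - 1 / 4) = 2 powr (real k / 2 - 1 / 4) * sqrt 2"
  proof -
    have "real (Suc k) / 2 - 1 / 4 = (real k / 2 - 1 / 4) + 1 / 2" by simp
    then show ?thesis by (simp only: powr_add powr_half_sqrt zero_le_numeral)
  qed
  then show ?thesis using assms by (simp add: window_start_def field_simps)
qed

text \<open>Induction over the windows. The term \<open>m / k\<close> cancels when the walk from
  \<open>m\<close> to \<open>n\<close> has slope \<open>1 / k\<close>, and the error
  \<open>\<gamma> * m / k\<^sup>2\<close> shrinks relative to \<open>n\<close> since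
  \<open>m\<close> is at most \<open>n / sqrt 2\<close>.\<close>

lemma growth_along_windows:
  fixes s :: "nat \<Rightarrow> real" and r :: "nat \<Rightarrow> nat"
  assumes step: "\<And>k n. k0 \<le> k \<Longrightarrow> window_start k \<le> real n \<Longrightarrow> real n \<le> 2 * window_start (Suc k) \<Longrightarrow>
      s (n + r k * k) \<le> s n + real (r k) * (1 + 1 / (real k)\<^sup>2)"
    and r: "\<And>k. 1 \<le> r k" and k0: "1 \<le> k0"
    and short: "\<And>k. k0 \<le> k \<Longrightarrow> real (r k * k) \<le> window_start (Suc k) / real (Suc k)"
    and gain: "\<And>k. k0 \<le> k \<Longrightarrow> 1 / real k + \<gamma> * 0.70711 / (real k)\<^sup>2 + 1 / (real k) ^ 3 \<le>
      1 / real (Suc k) + \<gamma> / (real (Suc k))\<^sup>2"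
    and base: "real k0 \<le> window_start k0"
  shows "\<exists>C\<ge>0. \<forall>k\<ge>k0. \<exists>m. window_start k \<le> real m \<and> real m \<le> window_start k * (1 + 1 / real k) \<and>
    s m \<le> real m / real k + \<gamma> * real m / (real k)\<^sup>2 + C"
proof -
  define m0 where "m0 = nat \<lceil>window_start k0\<rceil>"
  \<comment> \<open>\<open>C\<close> absorbs the unknown value at the start and is never
    increased.\<close>
  define C where "C = \<bar>s m0\<bar>"
  have "\<exists>m. window_start k \<le> real m \<and> real m \<le> window_start k * (1 + 1 / real k) \<and>
    s m \<le> real m / real k + \<gamma> * real m / (real k)\<^sup>2 + C" if "k0 \<le> k" for k
    using that
  proof (induction k rule: dec_induct)
    case base
    have "0 \<le> window_start k0" by (simp add: window_start_def)
    then have "window_start k0 \<le> real m0" "real m0 \<le> window_start k0 + 1"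
      unfolding m0_def by linarith+
    moreover have "1 \<le> window_start k0 / real k0"
      using assms(6) k0 by simp
    moreover have "0 \<le> real m0 / real k0 + \<gamma> * real m0 / (real k0)\<^sup>2"
      by (simp add: \<gamma>_def)
    ultimately show ?case
      by (intro exI[of _ m0]) (auto simp: C_def distrib_left)
  next
    case (step k)
    then obtain m where m: "window_start k \<le> real m" "real m \<le> window_start k * (1 + 1 / real k)"
      "s m \<le> real m / real k + \<gamma> * real m / (real k)\<^sup>2 + C" by blast
    have k: "1 \<le> k" using step k0 by simp
    let ?t = "window_start (Suc k)"
    have t0: "0 \<le> ?t" by (simp add: window_start_def)
    have m_le: "real m \<le> ?t / sqrt 2" using m(2) window_start_Suc[OF k] by simp
    also have "\<dots> \<le> ?t / 1" using t0 by (intro divide_left_mono) auto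
    finally have "real m \<le> ?t" by simp
    moreover have "s (n + r k * k) \<le> s n + real (r k) * (1 + 1 / (real k)\<^sup>2)" if "m \<le> n" "real n \<le> ?t" for n
      using that m(1) t0 step.hyps by (intro assms(1)) auto
    ultimately obtain n where n: "m \<le> n" "?t \<le> real n" "real n \<le> ?t + real (r k * k)"
      "s n \<le> s m + (real n - real m) / real k + real n / real k ^ 3"
      using advance_in_window[of k "r k" m ?t s] r[of k] k by auto
    \<comment> \<open>\<open>0.70711\<close> is a decimal just above
      \<open>1 / sqrt 2\<close>.\<close>
    have "real m \<le> 0.70711 * real n"
    proof -
      have "1 / 0.70711 \<le> sqrt 2" by (rule real_le_rsqrt) (simp add: power2_eq_square)
      then have "1 / sqrt 2 \<le> (0.70711 :: real)" by (simp add: field_simps)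
      then have "?t * (1 / sqrt 2) \<le> real n * 0.70711"
        using n t0 by (intro mult_mono) auto
      with m_le have "real m \<le> real n * 0.70711" by (simp only: times_divide_eq_right mult_1_right)
      then show ?thesis by (simp only: mult.commute)
    qed
    have "s n \<le> real m / real k + \<gamma> * real m / (real k)\<^sup>2 + C +
        ((real n - real m) / real k + real n / real k ^ 3)"
      using n(4) m(3) by linarith
    also have "\<dots> = real n / real k + \<gamma> * real m / (real k)\<^sup>2 + real n / real k ^ 3 + C"
      by (simp add: diff_divide_distrib)
    also have "\<dots> \<le> real n / real k + \<gamma> * (0.70711 * real n) / (real k)\<^sup>2 + real n / real k ^ 3 + C"
      using \<open>real m \<le> 0.70711 * real n\<close>
      by (intro add_right_mono add_left_mono divide_right_mono mult_left_mono) (auto simp: \<gamma>_def)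
    also have "\<dots> = real n * (1 / real k + \<gamma> * 0.70711 / (real k)\<^sup>2 + 1 / real k ^ 3) + C"
      by (simp add: distrib_left)
    also have "\<dots> \<le> real n * (1 / real (Suc k) + \<gamma> / (real (Suc k))\<^sup>2) + C"
      using gain[OF step.hyps(1)] by (intro add_right_mono mult_left_mono) auto
    finally have "s n \<le> real n / real (Suc k) + \<gamma> * real n / (real (Suc k))\<^sup>2 + C"
      by (simp add: distrib_left mult.commute)
    moreover have "real n \<le> ?t * (1 + 1 / real (Suc k))"
      using n(3) short[OF step.hyps(1)] by (simp add: distrib_left)
    ultimately show ?case using n(2) by blast
  qed
  then show ?thesis by (intro exI[of _ C]) (auto simp: C_def)
qed

text \<open>Replacing \<open>1 / k\<close> by \<open>1 / (k + 1)\<close> loses about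
  \<open>1 / k\<^sup>2\<close>, which is covered because
  \<open>\<gamma> * (1 - 0.70711) > 1\<close>.\<close>

lemma eventually_slope_le:
  "\<forall>\<^sub>F k::nat in sequentially. 1 / real k + \<gamma> * 0.70711 / (real k)\<^sup>2 + 1 / (real k) ^ 3 \<le>
      1 / real (Suc k) + \<gamma> / (real (Suc k))\<^sup>2"
  unfolding \<gamma>_def by real_asymp

text \<open>The decisive numerical fact is \<open>\<gamma> * 0.841 < \<beta>\<close>; all other
  terms are of smaller order.\<close>

lemma eventually_error_le:
  assumes "0 \<le> (C::real)"
  shows "\<forall>\<^sub>F k in sequentially. \<gamma> * (0.841 * (1 + 1 / real k)) / (real k)\<^sup>2 + 1 / (real k) ^ 3 +
      C / window_end k + 1 / sqrt (window_end k) \<le> \<beta> / (real k)\<^sup>2"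
  using assms unfolding \<gamma>_def \<beta>_def window_end_def by real_asymp

lemma eventually_window_start_le_end:
  "\<forall>\<^sub>F k in sequentially. window_start k * (1 + 1 / real k) \<le> window_end k"
  unfolding window_start_def window_end_def by real_asymp

section \<open>The number of planted sets, and the contradiction\<close>

text \<open>About \<open>n powr c\<close>, as \<open>n\<close> is roughly
  \<open>2 powr (k / 2)\<close>. It depends on \<open>k\<close> alone, so the step length is
  constant within a window.\<close>

definition planted :: "real \<Rightarrow> nat \<Rightarrow> nat" where
  "planted c k = nat \<lfloor>2 powr (c * real k / 2)\<rfloor>"

lemma planted_bounds:
  assumes "0 \<le> c"
  shows "1 \<le> planted c k" "real (planted c k) \<le> 2 powr (c * real k / 2)"
    "2 powr (c * real k / 2) / 2 \<le> real (planted c k)"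
proof -
  have "1 \<le> (2::real) powr (c * real k / 2)" using assms by (intro ge_one_powr_ge_zero) auto
  then show "1 \<le> planted c k" "real (planted c k) \<le> 2 powr (c * real k / 2)"
    "2 powr (c * real k / 2) / 2 \<le> real (planted c k)"
    using floor_correct[of "2 powr (c * real k / 2)"] le_floor_iff[of 1 "2 powr (c * real k / 2)"]
    unfolding planted_def by linarith+
qed

lemma eventually_planted_short:
  assumes "0 \<le> c" "c < 1 / 4"
  shows "\<forall>\<^sub>F k in sequentially. real (planted c k * k) \<le> window_start (Suc k) / real (Suc k)"
    and "\<forall>\<^sub>F k in sequentially. real (planted c k * k) \<le> window_end k / real k"
    and "\<forall>\<^sub>F k in sequentially. 2 * (real (planted c k * k))\<^sup>2 \<le> window_start k"
proof -
  have le: "real (planted c k * k) \<le> 2 powr (real k / 8) * real k" for k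
  proof -
    have "c * real k \<le> 1 / 4 * real k" using assms by (intro mult_right_mono) auto
    then have "(2::real) powr (c * real k / 2) \<le> 2 powr (real k / 8)" by (intro powr_mono) auto
    with planted_bounds(2)[OF assms(1), of k] have "real (planted c k) \<le> 2 powr (real k / 8)"
      by linarith
    then show ?thesis by (simp add: mult_right_mono)
  qed
  have "\<forall>\<^sub>F k::nat in sequentially. 2 powr (real k / 8) * real k \<le> window_start (Suc k) / real (Suc k)"
    unfolding window_start_def by real_asymp
  then show "\<forall>\<^sub>F k in sequentially. real (planted c k * k) \<le> window_start (Suc k) / real (Suc k)"
    by eventually_elim (rule order_trans[OF le])
  have "\<forall>\<^sub>F k::nat in sequentially. 2 powr (real k / 8) * real k \<le> window_end k / real k"
    unfolding window_end_def by real_asymp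
  then show "\<forall>\<^sub>F k in sequentially. real (planted c k * k) \<le> window_end k / real k"
    by eventually_elim (rule order_trans[OF le])
  have "\<forall>\<^sub>F k::nat in sequentially. 2 * (2 powr (real k / 8) * real k)\<^sup>2 \<le> window_start k"
    unfolding window_start_def by real_asymp
  then show "\<forall>\<^sub>F k in sequentially. 2 * (real (planted c k * k))\<^sup>2 \<le> window_start k"
  proof eventually_elim
    case (elim k)
    have "(real (planted c k * k))\<^sup>2 \<le> (2 powr (real k / 8) * real k)\<^sup>2"
      by (rule power_mono[OF le]) simp
    with elim show ?case by linarith
  qed
qed

text \<open>The gap between \<open>a\<close> and \<open>c\<close> makes the interval length a
  \<open>1 / k\<^sup>2\<close> fraction of the number of planted sets, so it fits into the error of
  a step.\<close>

lemma eventually_interval_le_planted: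
  assumes "0 \<le> a" "a < c"
  shows "\<forall>\<^sub>F k in sequentially. (2 * window_start (Suc k)) powr a \<le> real (planted c k) / (real k)\<^sup>2"
proof -
  have "\<forall>\<^sub>F k::nat in sequentially.
      (2 * window_start (Suc k)) powr a \<le> 2 powr (c * real k / 2) / 2 / (real k)\<^sup>2"
    using assms unfolding window_start_def by real_asymp
  then show ?thesis
  proof eventually_elim
    case (elim k)
    also have "2 powr (c * real k / 2) / 2 / (real k)\<^sup>2 \<le> real (planted c k) / (real k)\<^sup>2"
      using assms by (intro divide_right_mono planted_bounds(3)) auto
    finally show ?case .
  qed
qed

text \<open>After planting, at most \<open>r + u\<close> colours suffice with probability at least
  \<open>0.81 / 6\<close>. This exceeds 1/10, so some graph also has chromatic number at least
  \<open>l\<close>.\<close>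

lemma planted_upper_bound_step:
  assumes k: "2 \<le> k" "1 \<le> r" and n: "2 * (r * k)\<^sup>2 \<le> n + r * k"
    and exc: "(real r)\<^sup>2 * overlap_excess k (n + r * k - k) \<le> 1"
    and Pn: "9 / 10 < measure_pmf.prob (binomial_random_graph n (1/2)) {G. real (chromatic_number G) \<le> u}"
    and Pn': "9 / 10 < measure_pmf.prob (binomial_random_graph (n + r * k) (1/2)) {G. l \<le> real (chromatic_number G)}"
  shows "l \<le> u + real r"
proof -
  \<comment> \<open>A negative \<open>u\<close> would be changed by \<open>nat\<close>; it is
    excluded by the positive probability.\<close>
  have u: "0 \<le> u"
  proof (rule ccontr)
    assume "\<not> 0 \<le> u"
    then have "\<not> real (chromatic_number G) \<le> u" for G :: "nat ugraph"
      using of_nat_0_le_iff[of "chromatic_number G", where 'a = real] by linarith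
    then have empty: "{G :: nat ugraph. real (chromatic_number G) \<le> u} = {}" by blast
    show False using Pn unfolding empty by simp
  qed
  define M where "M = nat \<lfloor>u\<rfloor>"
  have "real m \<le> u \<longleftrightarrow> m \<le> M" for m
    using u unfolding M_def by linarith
  then have "9 / 10 < measure_pmf.prob (binomial_random_graph n (1/2)) {G. chromatic_number G \<le> M}"
    using Pn by simp
  then have "(9 / 10)\<^sup>2 / 6 \<le>
      (measure_pmf.prob (binomial_random_graph n (1/2)) {G. chromatic_number G \<le> M})\<^sup>2 / 6"
    by (intro divide_right_mono power_mono) auto
  also have "\<dots> \<le> measure_pmf.prob (binomial_random_graph (n + r * k) (1/2)) {G. chromatic_number G \<le> r + M}"
    by (rule planted_second_moment[OF k n exc])
  finally have "1 < measure_pmf.prob (binomial_random_graph (n + r * k) (1/2)) {G. chromatic_number G \<le> r + M}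
      + measure_pmf.prob (binomial_random_graph (n + r * k) (1/2)) {G. l \<le> real (chromatic_number G)}"
    using Pn' by (simp add: power2_eq_square)
  then obtain G :: "nat ugraph" where "chromatic_number G \<le> r + M" "l \<le> real (chromatic_number G)"
    using prob_intersect by (metis (no_types, lifting) mem_Collect_eq)
  moreover have "real M \<le> u" using u by (simp add: M_def)
  ultimately show ?thesis by linarith
qed

theorem theorem3:
  fixes c :: real
  assumes "c < 1 / 4"
  shows "\<not> (\<exists>I :: nat \<Rightarrow> real set.
           (\<forall>n\<ge>1. \<exists>s t. I n = {s..t} \<and> t - s = real n powr c) \<and>
           (\<lambda>n. measure_pmf.prob (binomial_random_graph n (1 / 2))
                  {G. real (chromatic_number G) \<in> I n}) \<longlonglongrightarrow> 1)"
proof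
  let ?P = "\<lambda>n. measure_pmf.prob (binomial_random_graph n (1 / 2))"
  assume "\<exists>I :: nat \<Rightarrow> real set.
           (\<forall>n\<ge>1. \<exists>s t. I n = {s..t} \<and> t - s = real n powr c) \<and>
           (\<lambda>n. ?P n {G. real (chromatic_number G) \<in> I n}) \<longlonglongrightarrow> 1"
  then obtain I :: "nat \<Rightarrow> real set"
    where I: "\<forall>n\<ge>1. \<exists>s t. I n = {s..t} \<and> t - s = real n powr c"
      and lim: "(\<lambda>n. ?P n {G. real (chromatic_number G) \<in> I n}) \<longlonglongrightarrow> 1"
    by blast
  obtain s t where st: "\<And>n. 1 \<le> n \<Longrightarrow> I n = {s n..t n} \<and> t n - s n = real n powr c"
    using I by metis
  have "\<forall>\<^sub>F n in sequentially. 9 / 10 < ?P n {G. real (chromatic_number G) \<in> I n}"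
    by (rule order_tendstoD(1)[OF lim]) simp
  then obtain N where N: "\<And>n. N \<le> n \<Longrightarrow> 9 / 10 < ?P n {G. real (chromatic_number G) \<in> I n}"
    by (auto simp: eventually_sequentially)
  have upper: "9 / 10 < ?P n {G. real (chromatic_number G) \<le> t n}"
    and lower: "9 / 10 < ?P n {G. s n \<le> real (chromatic_number G)}" if n: "N \<le> n" "1 \<le> n" for n
    using N[OF n(1)] st[OF n(2)]
    by (auto elim!: less_le_trans intro!: measure_pmf.finite_measure_mono)

  \<comment> \<open>\<open>c\<close> may be negative, hence the maximum; \<open>c'\<close> lies
    strictly between \<open>a\<close> and 1/4 and governs the number of planted sets.\<close>
  define a where "a = max c 0"
  define c' where "c' = (a + 1 / 4) / 2"
  have a: "0 \<le> a" "a < c'" "a < 1 / 4" and c': "0 \<le> c'" "c' < 1 / 4"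
    using assms by (auto simp: a_def c'_def)
  have powr_c: "real n powr c \<le> real n powr a" if "1 \<le> n" for n
    using that by (intro powr_mono) (auto simp: a_def)
  let ?r = "planted c'"

  have "\<forall>\<^sub>F k in sequentially. max (real N) (real k) \<le> window_start k"
    unfolding window_start_def by real_asymp
  moreover note eventually_overlap_excess_le[OF c'(2)] eventually_planted_short[OF c']
    eventually_interval_le_planted[OF a(1,2)] eventually_slope_le eventually_ge_at_top[of "2::nat"]
  ultimately have "\<forall>\<^sub>F k in sequentially. max (real N) (real k) \<le> window_start k \<and>
      (\<forall>m::nat. window_start k \<le> real m \<longrightarrow> 2 powr (c' * real k) * overlap_excess k (m - k) \<le> 1) \<and>
      real (?r k * k) \<le> window_start (Suc k) / real (Suc k) \<and>
      real (?r k * k) \<le> window_end k / real k \<and>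
      2 * (real (?r k * k))\<^sup>2 \<le> window_start k \<and>
      (2 * window_start (Suc k)) powr a \<le> real (?r k) / (real k)\<^sup>2 \<and>
      1 / real k + \<gamma> * 0.70711 / (real k)\<^sup>2 + 1 / (real k) ^ 3 \<le>
        1 / real (Suc k) + \<gamma> / (real (Suc k))\<^sup>2 \<and> 2 \<le> k"
    by (simp only: eventually_conj_iff)
  then obtain k0 where k0: "\<And>k. k0 \<le> k \<Longrightarrow> max (real N) (real k) \<le> window_start k \<and>
      (\<forall>m::nat. window_start k \<le> real m \<longrightarrow> 2 powr (c' * real k) * overlap_excess k (m - k) \<le> 1) \<and>
      real (?r k * k) \<le> window_start (Suc k) / real (Suc k) \<and>
      real (?r k * k) \<le> window_end k / real k \<and>
      2 * (real (?r k * k))\<^sup>2 \<le> window_start k \<and>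
      (2 * window_start (Suc k)) powr a \<le> real (?r k) / (real k)\<^sup>2 \<and>
      1 / real k + \<gamma> * 0.70711 / (real k)\<^sup>2 + 1 / (real k) ^ 3 \<le>
        1 / real (Suc k) + \<gamma> / (real (Suc k))\<^sup>2 \<and> 2 \<le> k"
    unfolding eventually_sequentially by blast
  have k0_2: "2 \<le> k0" using k0[of k0] by simp

  \<comment> \<open>Planting bounds the lower endpoint at \<open>n + ?r k * k\<close> by the upper
    endpoint at \<open>n\<close> plus \<open>?r k\<close>; the interval length at \<open>n\<close>
    is absorbed into the error.\<close>
  have step: "s (n + ?r k * k) \<le> s n + real (?r k) * (1 + 1 / (real k)\<^sup>2)"
    if k: "k0 \<le> k" and n: "window_start k \<le> real n" "real n \<le> 2 * window_start (Suc k)" for k n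
  proof -
    have k2: "2 \<le> k" "max (real N) (real k) \<le> real n" using k0[OF k] n by auto
    then have n1: "N \<le> n" "1 \<le> n" by auto
    have r: "1 \<le> ?r k" using planted_bounds(1)[OF c'(1)] .
    have "s (n + ?r k * k) \<le> t n + real (?r k)"
    proof (rule planted_upper_bound_step[OF k2(1) r])
      have "real (2 * (?r k * k)\<^sup>2) \<le> real n" using k0[OF k] n by simp
      then show "2 * (?r k * k)\<^sup>2 \<le> n + ?r k * k" by linarith
      have "(real (?r k))\<^sup>2 \<le> (2 powr (c' * real k / 2))\<^sup>2"
        using planted_bounds(2)[OF c'(1)] by (intro power_mono) auto
      also have "\<dots> = 2 powr (c' * real k)" by (simp add: powr_power)
      finally have "(real (?r k))\<^sup>2 * overlap_excess k (n + ?r k * k - k) \<le>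
          2 powr (c' * real k) * overlap_excess k (n + ?r k * k - k)"
        by (intro mult_right_mono overlap_excess_nonneg)
      also have "\<dots> \<le> 1"
      proof -
        have "window_start k \<le> real (n + ?r k * k)" by (rule order_trans[OF n(1)]) simp
        then show ?thesis using k0[OF k] by blast
      qed
      finally show "(real (?r k))\<^sup>2 * overlap_excess k (n + ?r k * k - k) \<le> 1" .
    qed (use upper lower n1 in auto)
    also have "t n = s n + real n powr c" using st[OF n1(2)] by simp
    also have "real n powr c \<le> (2 * window_start (Suc k)) powr a"
      using powr_c[OF n1(2)] powr_mono2[OF a(1) _ n(2)] by linarith
    also have "\<dots> \<le> real (?r k) / (real k)\<^sup>2" using k0[OF k] by blast
    finally show ?thesis by (simp add: algebra_simps)
  qed

  have "\<exists>C\<ge>0. \<forall>k\<ge>k0. \<exists>m. window_start k \<le> real m \<and> real m \<le> window_start k * (1 + 1 / real k) \<and>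
    s m \<le> real m / real k + \<gamma> * real m / (real k)\<^sup>2 + C"
    by (rule growth_along_windows[OF step]) (use k0 k0_2 planted_bounds(1)[OF c'(1)] in auto)
  then obtain C where C: "0 \<le> C" and growth: "\<And>k. k0 \<le> k \<Longrightarrow>
      \<exists>m. window_start k \<le> real m \<and> real m \<le> window_start k * (1 + 1 / real k) \<and>
        s m \<le> real m / real k + \<gamma> * real m / (real k)\<^sup>2 + C"
    by blast

  have "\<forall>\<^sub>F k in sequentially. k0 \<le> k \<and> 5 \<le> k" by (simp add: eventually_ge_at_top eventually_conj_iff)
  moreover note eventually_window_start_le_end eventually_error_le[OF C] eventually_prob_small
  ultimately have "\<forall>\<^sub>F k :: nat in sequentially. False"
  proof eventually_elim
    case (elim k)
    then have k: "k0 \<le> k" "5 \<le> k" by auto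
    obtain m where m: "window_start k \<le> real m" "real m \<le> window_start k * (1 + 1 / real k)"
      "s m \<le> real m / real k + \<gamma> * real m / (real k)\<^sup>2 + C"
      using growth[OF k(1)] by blast
    let ?r = "planted c' k" and ?t = "window_end k"
    have ws0: "0 < window_start k" "0 < window_start (Suc k)"
      using k by (auto simp: window_start_def)
    \<comment> \<open>\<open>0.841\<close> is a decimal just above \<open>2 powr (- 1 / 4)\<close>,
      the ratio of the two points.\<close>
    have start_end: "window_start k \<le> 0.841 * ?t" 
    proof -
      have "(2::real) powr (- 1 / 4) \<le> 0.841"
      proof (rule power_le_imp_le_base)
        show "((2::real) powr (- 1 / 4)) ^ Suc 3 \<le> 0.841 ^ Suc 3" by (simp add: powr_power power_divide)
      qed simp
      then have "?t * 2 powr (- 1 / 4) \<le> ?t * 0.841"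
        by (rule mult_left_mono) (simp add: window_end_def)
      moreover have "window_start k = ?t * 2 powr (- 1 / 4)"
      proof -
        have "real k / 2 - 1 / 4 = real k / 2 + (- 1 / 4)" by simp
        then show ?thesis
          unfolding window_start_def window_end_def by (simp only: powr_add) simp
      qed
      ultimately show ?thesis by simp
    qed
    have end_start: "?t \<le> 2 * window_start (Suc k)"
    proof -
      have "real k * 2 powr (real k / 2) \<le> real (Suc k) * 2 powr (1 + (real (Suc k) / 2 - 1 / 4))"
        by (intro mult_mono powr_mono) (auto simp: field_simps)
      also have "\<dots> = 2 * (real (Suc k) * 2 powr (real (Suc k) / 2 - 1 / 4))"
        by (simp only: powr_add) simp
      finally show ?thesis by (simp add: window_start_def window_end_def divide_right_mono)
    qed
    have "real m \<le> ?t" using m(2) elim by linarith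
    moreover have "s (n + ?r * k) \<le> s n + real ?r * (1 + 1 / (real k)\<^sup>2)" if "m \<le> n" "real n \<le> ?t" for n
      using that m(1) end_start by (intro step[OF k(1)]) auto
    \<comment> \<open>The last walk stops near \<open>window_end k\<close>, halfway through the
      window.\<close>
    ultimately obtain n where n: "m \<le> n" "?t \<le> real n" "real n \<le> ?t + real (?r * k)"
      "s n \<le> s m + (real n - real m) / real k + real n / real k ^ 3"
      using advance_in_window[of k ?r m ?t s] planted_bounds(1)[OF c'(1), of k] k by auto
    have t0: "0 < ?t" using k by (simp add: window_end_def)
    have n0: "0 < real n" "N \<le> n" "1 \<le> n"
    proof -
      show "0 < real n" using n(2) t0 by linarith
      then show "1 \<le> n" by simp
      have "real N \<le> real m" using k0[OF k(1)] m(1) by simp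
      then show "N \<le> n" using n(1) by simp
    qed

    have "real m \<le> 0.841 * (1 + 1 / real k) * real n"
    proof -
      have "real m \<le> 0.841 * ?t * (1 + 1 / real k)"
        using m(2) start_end by (elim order_trans) (intro mult_right_mono, auto)
      also have "\<dots> \<le> 0.841 * real n * (1 + 1 / real k)"
        using n(2) by (intro mult_right_mono) auto
      finally show ?thesis by (simp only: mult_ac)
    qed
    then have gm: "\<gamma> * real m / (real k)\<^sup>2 \<le> \<gamma> * (0.841 * (1 + 1 / real k) * real n) / (real k)\<^sup>2"
      by (intro divide_right_mono mult_left_mono) (auto simp: \<gamma>_def)
    have "s n \<le> real m / real k + \<gamma> * (0.841 * (1 + 1 / real k) * real n) / (real k)\<^sup>2 + C +
        ((real n - real m) / real k + real n / real k ^ 3)"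
      using n(4) m(3) gm by linarith
    then have s_le: "s n \<le> real n / real k +
        real n * (\<gamma> * (0.841 * (1 + 1 / real k)) / (real k)\<^sup>2 + 1 / real k ^ 3) + C"
      by (simp add: diff_divide_distrib distrib_left mult_ac)

    define b where "b = real k - \<beta>"
    have b: "0 < b" using k by (simp add: b_def \<beta>_def)
    have "real n \<le> ?t * (1 + 1 / real k)"
      using n(3) k0[OF k(1)] by (simp add: distrib_left)
    then have "?P n {G. chromatic_number G \<le> nat \<lfloor>real n / b\<rfloor>} \<le> 1 / 4"
      using elim n(2) by (simp add: b_def)
    moreover have "?P n {G. \<not> chromatic_number G \<le> nat \<lfloor>real n / b\<rfloor>} =
        1 - ?P n {G. chromatic_number G \<le> nat \<lfloor>real n / b\<rfloor>}"
      using measure_pmf.prob_neg[of "binomial_random_graph n (1/2)" "\<lambda>G. chromatic_number G \<le> nat \<lfloor>real n / b\<rfloor>"] by simp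
    \<comment> \<open>Probability 3/4 for more than \<open>n / b\<close> colours and 9/10 for at
      most \<open>t n\<close> give a common graph, so \<open>n / b\<close> is at most
      \<open>t n\<close>.\<close>
    ultimately have "1 < ?P n {G. \<not> chromatic_number G \<le> nat \<lfloor>real n / b\<rfloor>} +
        ?P n {G. real (chromatic_number G) \<le> t n}"
      using upper[OF n0(2,3)] by linarith
    then obtain G :: "nat ugraph"
      where G: "nat \<lfloor>real n / b\<rfloor> < chromatic_number G" "real (chromatic_number G) \<le> t n"
      using prob_intersect by (metis (no_types, lifting) mem_Collect_eq not_le)
    have "real n / b \<le> t n" using G by linarith
    also have "t n = s n + real n powr c" using st[OF n0(3)] by simp
    also have "real n powr c \<le> sqrt (real n)"
      using n0(3) assms powr_mono[of c "1/2" "real n"] by (simp add: powr_half_sqrt)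
    finally have low: "real n / b \<le> s n + sqrt (real n)" by simp

    \<comment> \<open>The lower bound \<open>n / (k - \<beta>)\<close> beats its expansion to second
      order, while the upper bound has a smaller second coefficient.\<close>
    have "real n / real k + real n * \<beta> / (real k)\<^sup>2 < real n / b"
    proof -
      have "(1 / real k + \<beta> / (real k)\<^sup>2) * b = 1 - (\<beta> / real k)\<^sup>2"
        using k by (simp add: b_def field_simps power2_eq_square)
      also have "\<dots> < 1" using k by (simp add: \<beta>_def)
      finally have "1 / real k + \<beta> / (real k)\<^sup>2 < 1 / b"
        using b by (simp add: pos_less_divide_eq)
      then have "real n * (1 / real k + \<beta> / (real k)\<^sup>2) < real n * (1 / b)"
        using n0 by (intro mult_strict_left_mono) auto
      then show ?thesis by (simp add: distrib_left)
    qed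
    moreover have "real n * \<beta> / (real k)\<^sup>2 \<ge>
        real n * (\<gamma> * (0.841 * (1 + 1 / real k)) / (real k)\<^sup>2 + 1 / real k ^ 3) + C + sqrt (real n)"
    proof -
      have "real n * (\<gamma> * (0.841 * (1 + 1 / real k)) / (real k)\<^sup>2 + 1 / real k ^ 3 +
          C / ?t + 1 / sqrt ?t) \<le> real n * (\<beta> / (real k)\<^sup>2)"
        using elim by (intro mult_left_mono) auto
      moreover have "C \<le> real n * (C / ?t)"
        using mult_right_mono[OF n(2) C] t0 by (simp add: field_simps)
      moreover have "sqrt (real n) \<le> real n * (1 / sqrt ?t)"
      proof -
        have "sqrt (real n) * sqrt ?t \<le> sqrt (real n) * sqrt (real n)"
          using n(2) by (intro mult_left_mono) auto
        then show ?thesis using t0 by (simp add: pos_le_divide_eq)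
      qed
      ultimately show ?thesis by (simp add: distrib_left)
    qed
    ultimately show False using low s_le by linarith
  qed
  then show False by simp
qed

end
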